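(* Let $t\mapsto\mu_t$ be a piecewise continuous function from $[0,\infty)$ to the set of positive Borel measures on $\mathbb T$ such that $\mu_t(\mathbb T)$ is uniformly bounded, let $g_t$ be the solution of the associated radial Löwner equation, $f_t=g_t^{-1}:\mathbb D\to\mathbb D\setminus\mathcal K_t$, and $\psi_t(z)=\frac{f_t(z)}{1-f_t(z)}$ for $z\in\mathbb D$. Then for each $t\in[0,\infty)$ there exists a unique probability measure $\nu_t$ on $\mathbb T$ such that $$\psi_t(z)=\int_0^{2\pi}\frac{ze^{-i\theta}}{1-ze^{-i\theta}}\,\nu_t(d\theta),\qquad z\in\mathbb D.$$
   Context: Notation: $\mathbb D$ is the open unit disk, $\mathbb T=\{z\in\mathbb C:|z|=1\}$; measures on $\mathbb T$ carry the weak topology and are identified with measures on $[0,2\pi)$. For $z\in\mathbb D$ let $g_t(z)$ solve the radial Löwner equation $$\partial_t g_t(z)=g_t(z)\int_0^{2\pi}\frac{e^{i\theta}+g_t(z)}{e^{i\theta}-g_t(z)}\,\mu_t(d\theta),\qquad g_0(z)=z,$$ up to its maximal existence time $T_z\in(0,\infty]$, and let $\mathcal K_t$ be the closure of $\{z\in\mathbb D:T_z\le t\}$. Then $g_t$ is a conformal map of $\mathbb D\setminus\mathcal K_t$ onto $\mathbb D$ with $g_t(0)=0$ and $g_t'(0)>0$. *)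

theory Defs
  imports "HOL-Probability.Probability_Measure"
begin

text \<open>Measures on the unit circle are Borel measures on the set \<open>sphere 0 1\<close> itself, with
  \<open>w = exp (\<i> \<theta>)\<close>. The weak topology is therefore that of the circle, where the angles near
  \<open>0\<close> and near \<open>2 * pi\<close> are close to each other.\<close>

definition circle_measures :: "complex measure set" where
  "circle_measures = {\<mu>. sets \<mu> = sets (restrict_space borel (sphere 0 1))}"

definition weak_tendsto :: "('a \<Rightarrow> complex measure) \<Rightarrow> complex measure \<Rightarrow> 'a filter \<Rightarrow> bool" where
  "weak_tendsto \<mu> \<nu> F \<longleftrightarrow>
    (\<forall>h :: complex \<Rightarrow> real. continuous_on (sphere 0 1) h \<longrightarrow>
      ((\<lambda>t. \<integral>w. h w \<partial>\<mu> t) \<longlongrightarrow> (\<integral>w. h w \<partial>\<nu>)) F)"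

definition weakly_continuous_at :: "(real \<Rightarrow> complex measure) \<Rightarrow> real \<Rightarrow> bool" where
  "weakly_continuous_at \<mu> t \<longleftrightarrow> weak_tendsto \<mu> (\<mu> t) (at t within {0..})"

text \<open>Piecewise continuity on \<open>[0, \<infinity>)\<close>: finitely many exceptional times in each bounded interval,
  with one-sided limits at each of them; the value at an exceptional time is arbitrary.\<close>

definition piecewise_weakly_continuous :: "(real \<Rightarrow> complex measure) \<Rightarrow> bool" where
  "piecewise_weakly_continuous \<mu> \<longleftrightarrow>
    (\<exists>S \<subseteq> {0..}.
      (\<forall>b. finite (S \<inter> {0..b})) \<and>
      (\<forall>t\<in>{0..} - S. weakly_continuous_at \<mu> t) \<and>
      (\<forall>t\<in>S. (\<exists>\<nu>\<in>circle_measures. finite_measure \<nu> \<and> weak_tendsto \<mu> \<nu> (at_right t)) \<and>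
        (t > 0 \<longrightarrow> (\<exists>\<nu>\<in>circle_measures. finite_measure \<nu> \<and> weak_tendsto \<mu> \<nu> (at_left t)))))"

text \<open>A solution on \<open>[0, T)\<close> takes values in the open disk, the domain of the vector field.
  It is continuous throughout and differentiable wherever \<open>\<mu>\<close> is continuous; at a jump
  of \<open>\<mu>\<close> the two-sided derivative need not exist.\<close>

definition loewner_solution ::
    "(real \<Rightarrow> complex measure) \<Rightarrow> complex \<Rightarrow> ereal \<Rightarrow> (real \<Rightarrow> complex) \<Rightarrow> bool" where
  "loewner_solution \<mu> z T g \<longleftrightarrow>
    g 0 = z \<and>
    continuous_on {t. 0 \<le> t \<and> ereal t < T} g \<and>
    (\<forall>t. 0 \<le> t \<and> ereal t < T \<longrightarrow>
      g t \<in> ball 0 1 \<and>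
      (weakly_continuous_at \<mu> t \<longrightarrow>
        (g has_vector_derivative (g t * (\<integral>w. (w + g t) / (w - g t) \<partial>\<mu> t))) (at t within {0..})))"

definition loewner_lifetime :: "(real \<Rightarrow> complex measure) \<Rightarrow> complex \<Rightarrow> ereal" where
  "loewner_lifetime \<mu> z = Sup {T. 0 < T \<and> (\<exists>g. loewner_solution \<mu> z T g)}"

definition loewner_map :: "(real \<Rightarrow> complex measure) \<Rightarrow> real \<Rightarrow> complex \<Rightarrow> complex" where
  "loewner_map \<mu> t z = (THE w. \<exists>T g. ereal t < T \<and> loewner_solution \<mu> z T g \<and> w = g t)"

definition loewner_hull :: "(real \<Rightarrow> complex measure) \<Rightarrow> real \<Rightarrow> complex set" where
  "loewner_hull \<mu> t = closure {z \<in> ball 0 1. loewner_lifetime \<mu> z \<le> ereal t}"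

definition loewner_inverse :: "(real \<Rightarrow> complex measure) \<Rightarrow> real \<Rightarrow> complex \<Rightarrow> complex" where
  "loewner_inverse \<mu> t = the_inv_into (ball 0 1 - loewner_hull \<mu> t) (loewner_map \<mu> t)"

definition loewner_psi :: "(real \<Rightarrow> complex measure) \<Rightarrow> real \<Rightarrow> complex \<Rightarrow> complex" where
  "loewner_psi \<mu> t z = loewner_inverse \<mu> t z / (1 - loewner_inverse \<mu> t z)"

end

theory Submission
  imports Defs "HOL-Probability.Probability" "HOL-Complex_Analysis.Complex_Analysis"
begin

text \<open>
  Put \<open>f\<close> for the inverse Loewner map at time \<open>t\<close>. If \<open>f\<close> is a holomorphic self-map of the disk with
  \<open>f 0 = 0\<close>, then \<open>\<psi> = f / (1 - f)\<close> satisfies \<open>1 + 2 \<psi> = (1 + f) / (1 - f)\<close>, a function with positive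
  real part and value \<open>1\<close> at the origin, and the representing measure is the Herglotz measure of
  that function. So there are two tasks.

  \<^bold>\<open>The inverse map.\<close> Let \<open>p s x\<close> be the integral of \<open>(w + x) / (w - x)\<close> against \<open>\<mu> s\<close>, so that the
  equation is \<open>g' s = g s * p s (g s)\<close>. Its solutions satisfy \<open>g s = g t exp (\<integral> p)\<close>, the integral being taken
  from \<open>t\<close> to \<open>s\<close>. Prescribing the value \<open>w\<close> at time \<open>t\<close>, Picard iteration in this exponential form
  never leaves a compact disk: before \<open>t\<close> since \<open>Re p\<close> is nonnegative, and for a short time after
  \<open>t\<close> since \<open>p\<close> is bounded there. This gives a solution through every \<open>w\<close> in the disk that
  exists beyond \<open>t\<close> (\<open>loewner_solution_through\<close>), and \<open>f w\<close> is its value at time \<open>0\<close>. The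
  difference of two solutions satisfies a scalar linear equation, hence equals its initial value
  times an explicit exponential (\<open>trajectory_diff\<close>). This one identity yields uniqueness in both
  time directions, injectivity of \<open>f\<close>, and, on letting the two solutions approach each other,
  complex differentiability of \<open>f\<close> (\<open>holomorphic_initial_value\<close>). The image of \<open>f\<close> is the set of
  points that survive beyond \<open>t\<close>; it is open by the open mapping theorem, and therefore it is exactly
  the complement of the hull in the disk, although the hull is defined by a closure
  (\<open>loewner_inverse_self_map\<close>).

  \<^bold>\<open>The measure.\<close> On a circle of radius \<open>r < 1\<close> the density \<open>1 + 2 Re \<psi>\<close> defines a probability
  measure whose Fourier coefficients are the Taylor coefficients of \<open>\<psi>\<close> times powers of \<open>r\<close>. By
  Helly's selection theorem a subsequence converges weakly as \<open>r\<close> tends to \<open>1\<close>, which produces a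
  measure whose moments are the Taylor coefficients (\<open>boundary_moments\<close>); expanding the kernel as a
  geometric series gives the representation. Conversely the integral determines the moments, and
  the moments determine the measure by the Stone-Weierstrass theorem
  (\<open>circle_measure_eqI_moments\<close>).
\<close>

section \<open>Measures on the circle\<close>

lemma circle_measures_space:
  assumes "\<nu> \<in> circle_measures"
  shows "space \<nu> = sphere 0 1"
proof -
  have "space \<nu> = space (restrict_space borel (sphere 0 1 :: complex set))"
    using assms by (intro sets_eq_imp_space_eq) (simp add: circle_measures_def)
  then show ?thesis by (simp add: space_restrict_space)
qed

lemma circle_measures_borel_measurable:
  fixes f :: "complex \<Rightarrow> 'b::topological_space"
  assumes "\<nu> \<in> circle_measures" "continuous_on (sphere 0 1) f"
  shows "f \<in> borel_measurable \<nu>"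
proof -
  have "f \<in> borel_measurable (restrict_space borel (sphere 0 1))"
    by (rule borel_measurable_continuous_on_restrict[OF assms(2)])
  moreover have "measurable \<nu> borel = measurable (restrict_space borel (sphere 0 1)) (borel :: 'b measure)"
    using assms(1) by (intro measurable_cong_sets) (auto simp: circle_measures_def)
  ultimately show ?thesis by simp
qed

lemma circle_measures_integrable:
  fixes f :: "complex \<Rightarrow> 'b::{banach, second_countable_topology}"
  assumes "\<nu> \<in> circle_measures" "finite_measure \<nu>" "continuous_on (sphere 0 1) f"
  shows "integrable \<nu> f"
proof -
  interpret finite_measure \<nu> by fact
  have "bounded (f ` sphere 0 1)"
    by (intro compact_imp_bounded compact_continuous_image assms) auto
  then obtain B where B: "\<forall>w\<in>sphere 0 1. norm (f w) \<le> B"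
    unfolding bounded_iff by blast
  show ?thesis
    by (rule integrable_const_bound[of _ B])
       (use B assms circle_measures_space circle_measures_borel_measurable in auto)
qed

lemma continuous_on_section:
  assumes "continuous_on (A \<times> B) (\<lambda>(x, y). k x y)" "x \<in> A"
  shows "continuous_on B (k x)"
proof -
  have "continuous_on B (\<lambda>y. (case (x, y) of (x, y) \<Rightarrow> k x y))"
    by (rule continuous_on_compose2[OF assms(1)]) (use assms(2) in \<open>auto intro!: continuous_intros\<close>)
  then show ?thesis by simp
qed

text \<open>Piecewise continuity enters as finiteness of the set of jumps in each bounded interval: a
  bounded integrand that is continuous off a finite set is integrable, and a finite set of
  exceptional times is harmless for the fundamental theorem of calculus.\<close>

locale radial_driving =
  fixes \<mu> :: "real \<Rightarrow> complex measure" and M :: real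
  assumes circle: "t \<ge> 0 \<Longrightarrow> \<mu> t \<in> circle_measures"
    and finite_jumps: "finite {s \<in> {0..b}. \<not> weakly_continuous_at \<mu> s}"
    and mass_emeasure: "t \<ge> 0 \<Longrightarrow> emeasure (\<mu> t) (sphere 0 1) \<le> ennreal M"
    and M_nonneg: "0 \<le> M"
begin

lemma driving_finite: "t \<ge> 0 \<Longrightarrow> finite_measure (\<mu> t)"
  using mass_emeasure[of t] circle_measures_space[OF circle, of t]
  by (intro finite_measureI) (auto simp: top_unique)

lemma mass: "t \<ge> 0 \<Longrightarrow> measure (\<mu> t) (space (\<mu> t)) \<le> M"
  using mass_emeasure[of t] circle_measures_space[OF circle, of t] M_nonneg
  by (simp add: measure_def enn2real_leI)

lemma integrable_circle:
  fixes f :: "complex \<Rightarrow> 'b::{banach, second_countable_topology}"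
  assumes "t \<ge> 0" "continuous_on (sphere 0 1) f"
  shows "integrable (\<mu> t) f"
  using circle_measures_integrable[OF circle driving_finite] assms by blast

lemma norm_integral_le:
  fixes f :: "complex \<Rightarrow> 'b::{banach, second_countable_topology}"
  assumes "t \<ge> 0" "continuous_on (sphere 0 1) f" "\<And>w. norm w = 1 \<Longrightarrow> norm (f w) \<le> B"
  shows "norm (\<integral>w. f w \<partial>\<mu> t) \<le> B * M"
proof -
  interpret finite_measure "\<mu> t" by (rule driving_finite[OF assms(1)])
  have "0 \<le> B" using assms(3)[of 1] norm_ge_zero[of "f 1"] by (simp del: norm_ge_zero)
  have "norm (\<integral>w. f w \<partial>\<mu> t) \<le> (\<integral>w. norm (f w) \<partial>\<mu> t)" by (rule integral_norm_bound)
  also have "\<dots> \<le> (\<integral>w. B \<partial>\<mu> t)"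
    using assms circle_measures_space[OF circle[OF assms(1)]]
    by (intro integral_mono integrable_circle continuous_intros) auto
  also have "\<dots> = B * measure (\<mu> t) (space (\<mu> t))" by simp
  also have "\<dots> \<le> B * M" by (intro mult_left_mono mass \<open>0 \<le> B\<close> assms)
  finally show ?thesis .
qed

lemma weakly_continuous_complex:
  fixes f :: "complex \<Rightarrow> complex"
  assumes "weakly_continuous_at \<mu> s" "s \<ge> 0" "continuous_on (sphere 0 1) f"
  shows "((\<lambda>u. \<integral>w. f w \<partial>\<mu> u) \<longlongrightarrow> (\<integral>w. f w \<partial>\<mu> s)) (at s within {0..})"
proof -
  have Re: "((\<lambda>u. \<integral>w. Re (f w) \<partial>\<mu> u) \<longlongrightarrow> (\<integral>w. Re (f w) \<partial>\<mu> s)) (at s within {0..})"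
   and Im: "((\<lambda>u. \<integral>w. Im (f w) \<partial>\<mu> u) \<longlongrightarrow> (\<integral>w. Im (f w) \<partial>\<mu> s)) (at s within {0..})"
    using assms unfolding weakly_continuous_at_def weak_tendsto_def
    by (auto intro!: continuous_intros)
  have eq: "(\<integral>w. f w \<partial>\<mu> u) = Complex (\<integral>w. Re (f w) \<partial>\<mu> u) (\<integral>w. Im (f w) \<partial>\<mu> u)" if "u \<ge> 0" for u
    using integrable_circle[OF that assms(3)] by (simp add: complex_eq_iff)
  have ev: "\<forall>\<^sub>F u in at s within {0..}. u \<ge> 0"
    by (auto simp: eventually_at_filter)
  show ?thesis
    unfolding eq[OF assms(2)]
    by (rule Lim_transform_eventually[OF tendsto_Complex[OF Re Im]])
       (use ev in eventually_elim, simp add: eq)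
qed

text \<open>Here both the kernel and the measure vary with time. Compactness of \<open>{0..b} \<times> sphere 0 1\<close> makes
  the kernel vary uniformly on the circle, and since the masses are bounded this part of the change is
  negligible; what remains is a fixed kernel, to which weak continuity applies.\<close>

lemma continuous_within_integral:
  fixes k :: "real \<Rightarrow> complex \<Rightarrow> complex"
  assumes k: "continuous_on ({0..b} \<times> sphere 0 1) (\<lambda>(s, w). k s w)"
    and s: "s \<in> {0..b}" "weakly_continuous_at \<mu> s"
  shows "continuous (at s within {0..b}) (\<lambda>u. \<integral>w. k u w \<partial>\<mu> u)"
proof -
  have kc: "continuous_on (sphere 0 1) (k u)" if "u \<in> {0..b}" for u
    using continuous_on_section[OF k that] by simp
  have near: "((\<lambda>u. (\<integral>w. k u w \<partial>\<mu> u) - (\<integral>w. k s w \<partial>\<mu> u)) \<longlongrightarrow> 0) (at s within {0..b})"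
  proof (rule tendstoI)
    fix e :: real assume "e > 0"
    define e' where "e' = e / (2 * (M + 1))"
    have "e' > 0" using \<open>e > 0\<close> M_nonneg by (simp add: e'_def)
    have "uniformly_continuous_on ({0..b} \<times> sphere 0 1) (\<lambda>(s, w). k s w)"
      by (intro compact_uniformly_continuous k compact_Times) auto
    then obtain d where "d > 0" and d: "\<And>u v w. \<lbrakk>u \<in> {0..b}; v \<in> {0..b}; norm w = 1; dist u v < d\<rbrakk>
        \<Longrightarrow> dist (k u w) (k v w) < e'"
      using \<open>e' > 0\<close> unfolding uniformly_continuous_on_def
      by (fastforce simp: dist_Pair_Pair)
    have "\<forall>\<^sub>F u in at s within {0..b}. u \<in> {0..b} \<and> dist u s < d"
      using \<open>d > 0\<close> by (auto simp: eventually_at)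
    then show "\<forall>\<^sub>F u in at s within {0..b}. dist ((\<integral>w. k u w \<partial>\<mu> u) - (\<integral>w. k s w \<partial>\<mu> u)) 0 < e"
    proof eventually_elim
      case (elim u)
      have "(\<integral>w. k u w \<partial>\<mu> u) - (\<integral>w. k s w \<partial>\<mu> u) = (\<integral>w. k u w - k s w \<partial>\<mu> u)"
        using elim s by (intro Bochner_Integration.integral_diff[symmetric] integrable_circle kc) auto
      also have "norm \<dots> \<le> e' * M"
        using elim s d[of u s] by (intro norm_integral_le continuous_intros kc) (force simp: dist_norm)+
      also have "\<dots> < e"
        using \<open>e > 0\<close> M_nonneg by (simp add: e'_def field_simps) (smt (verit) mult_nonneg_nonneg)
      finally show ?case by simp
    qed
  qed
  have "((\<lambda>u. \<integral>w. k s w \<partial>\<mu> u) \<longlongrightarrow> (\<integral>w. k s w \<partial>\<mu> s)) (at s within {0..b})"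
    using weakly_continuous_complex[OF s(2) _ kc[OF s(1)]] s
    by (auto elim: tendsto_within_subset)
  from tendsto_add[OF near this] show ?thesis by (simp add: continuous_within)
qed

lemma integrable_on_integral:
  fixes k :: "real \<Rightarrow> complex \<Rightarrow> complex"
  assumes k: "continuous_on ({0..b} \<times> sphere 0 1) (\<lambda>(s, w). k s w)"
  shows "(\<lambda>u. \<integral>w. k u w \<partial>\<mu> u) integrable_on {0..b}"
proof -
  let ?N = "{s \<in> {0..b}. \<not> weakly_continuous_at \<mu> s}"
  let ?K = "\<lambda>u. \<integral>w. k u w \<partial>\<mu> u"
  have "bounded ((\<lambda>(s, w). k s w) ` ({0..b} \<times> sphere 0 1))"
    by (intro compact_imp_bounded compact_continuous_image k compact_Times) auto
  then obtain B where B: "\<And>s w. s \<in> {0..b} \<Longrightarrow> norm w = 1 \<Longrightarrow> norm (k s w) \<le> B"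
    unfolding bounded_iff by fastforce
  have kc: "continuous_on (sphere 0 1) (k u)" if "u \<in> {0..b}" for u
    using continuous_on_section[OF k that] by simp
  have neg: "negligible ?N" by (intro negligible_finite finite_jumps)
  have meas: "{0..b} - ?N \<in> sets lebesgue"
    using neg by (intro sets.Diff) (auto intro: negligible_imp_sets)
  have "continuous_on ({0..b} - ?N) ?K"
    unfolding continuous_on_eq_continuous_within
    by (auto intro!: continuous_within_subset[OF continuous_within_integral[OF k]])
  then have "?K \<in> borel_measurable (lebesgue_on ({0..b} - ?N))"
    using meas by (rule continuous_imp_measurable_on_sets_lebesgue)
  moreover have "(\<lambda>u. B * M) integrable_on ({0..b} - ?N)"
    by (rule integrable_spike_set[of _ "{0..b}"])
       (auto intro!: negligible_subset[OF neg] simp: integrable_const_ivl)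
  ultimately have "?K absolutely_integrable_on ({0..b} - ?N)"
    using meas B by (intro measurable_bounded_by_integrable_imp_absolutely_integrable[where g="\<lambda>u. B * M"])
      (auto intro!: norm_integral_le kc)
  then have "?K integrable_on ({0..b} - ?N)" by (rule set_lebesgue_integral_eq_integral)
  then show ?thesis
    by (rule integrable_spike_set) (auto intro!: negligible_subset[OF neg])
qed

end

section \<open>The vector field and its difference quotient\<close>

text \<open>Multiplying by the integrating factor gives a continuous function whose derivative vanishes off
  a finite set, so it is constant.\<close>

lemma linear_ode_finite_exceptions:
  fixes u \<alpha> :: "real \<Rightarrow> complex"
  assumes "finite N" and u: "continuous_on {a..b} u" and \<alpha>: "\<alpha> integrable_on {a..b}"
    and \<alpha>_cont: "\<And>s. s \<in> {a..b} - N \<Longrightarrow> continuous (at s within {a..b}) \<alpha>"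
    and deriv: "\<And>s. s \<in> {a<..<b} - N \<Longrightarrow> (u has_vector_derivative u s * \<alpha> s) (at s)"
    and s: "s \<in> {a..b}"
  shows "u s = u a * exp (integral {a..s} \<alpha>)"
proof -
  define v where "v s = u s * exp (- integral {a..s} \<alpha>)" for s
  have I: "continuous_on {a..b} (\<lambda>s. integral {a..s} \<alpha>)"
    by (rule indefinite_integral_continuous_1[OF \<alpha>])
  have "v s = v a"
  proof (rule has_derivative_zero_unique_strong_interval[of "N \<union> {a, b}" a b v "v a" s])
    show "continuous_on {a..b} v"
      unfolding v_def by (intro continuous_intros u I)
    fix x assume x: "x \<in> {a..b} - (N \<union> {a, b})"
    have at: "at x within {a..b} = at x" using x by (intro at_within_interior) auto
    have "((\<lambda>s. integral {a..s} \<alpha>) has_vector_derivative \<alpha> x) (at x within {a..b})"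
      using integral_has_vector_derivative_continuous_at[OF \<alpha>, of x "{}"] \<alpha>_cont[of x] x by simp
    then have "((\<lambda>s. - integral {a..s} \<alpha>) has_vector_derivative - \<alpha> x) (at x)"
      unfolding at by (rule has_vector_derivative_minus)
    then have "((\<lambda>s. exp (- integral {a..s} \<alpha>)) has_vector_derivative
        (- \<alpha> x) * exp (- integral {a..x} \<alpha>)) (at x)"
      using field_vector_diff_chain_at[of "\<lambda>s. - integral {a..s} \<alpha>" "- \<alpha> x" x exp, OF _ DERIV_exp]
      by (simp add: o_def)
    then have "(v has_vector_derivative
        (u x * ((- \<alpha> x) * exp (- integral {a..x} \<alpha>)) + u x * \<alpha> x * exp (- integral {a..x} \<alpha>))) (at x)"
      unfolding v_def using x by (intro has_vector_derivative_mult deriv) auto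
    then show "(v has_derivative (\<lambda>h. 0)) (at x within {a..b})"
      unfolding at by (simp add: has_vector_derivative_def algebra_simps)
  qed (use assms in auto)
  then have "u s * exp (- integral {a..s} \<alpha>) * exp (integral {a..s} \<alpha>) = u a * exp (integral {a..s} \<alpha>)"
    by (simp add: v_def)
  then show ?thesis by (simp add: mult.assoc flip: exp_add)
qed

text \<open>The mean value inequality on a half-plane, which is convex.\<close>

lemma norm_exp_diff_le:
  fixes a b :: complex
  assumes "Re a \<le> c" "Re b \<le> c"
  shows "norm (exp a - exp b) \<le> exp c * norm (a - b)"
proof (rule field_differentiable_bound[of "{z. Re z \<le> c}" exp exp])
  show "convex {z. Re z \<le> c}" by (rule convex_halfspace_Re_le)
qed (use assms in \<open>auto intro!: DERIV_exp has_field_derivative_at_within\<close>)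

lemma unit_minus_nonzero:
  fixes w x :: complex
  assumes "norm w = 1" "norm x < 1"
  shows "w - x \<noteq> 0" "w \<noteq> x" "x \<noteq> w"
  using assms by auto

lemma norm_unit_minus_ge:
  fixes w x :: complex
  assumes "norm w = 1" "norm x \<le> \<rho>"
  shows "1 - \<rho> \<le> norm (w - x)"
  using norm_triangle_ineq2[of w x] assms by simp

text \<open>The real part is \<open>(1 - |x|\<^sup>2) / |w - x|\<^sup>2\<close>.\<close>

lemma Re_cayley_nonneg:
  fixes w x :: complex
  assumes "norm w = 1" "norm x \<le> 1"
  shows "0 \<le> Re ((w + x) / (w - x))"
proof -
  have "(Re x)\<^sup>2 + (Im x)\<^sup>2 \<le> 1" "(Re w)\<^sup>2 + (Im w)\<^sup>2 = 1"
    using assms by (auto simp: cmod_def)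
  then have "0 \<le> Re (w + x) * Re (w - x) + Im (w + x) * Im (w - x)"
    by (simp add: algebra_simps power2_eq_square)
  then show ?thesis by (simp add: Re_divide)
qed

context radial_driving
begin

text \<open>The vector field of the equation is \<open>x * herglotz s x\<close>. Its divided difference at \<open>x\<close> and \<open>y\<close> is
  \<open>slope s x y\<close>; the formula as an integral, which uses
  \<open>x (w + x) / (w - x) = 2 w\<^sup>2 / (w - x) - x - 2 w\<close>, also makes sense for \<open>x = y\<close>.\<close>

definition herglotz :: "real \<Rightarrow> complex \<Rightarrow> complex" where
  "herglotz s x = (\<integral>w. (w + x) / (w - x) \<partial>\<mu> s)"

definition slope :: "real \<Rightarrow> complex \<Rightarrow> complex \<Rightarrow> complex" where
  "slope s x y = (\<integral>w. 2 * w\<^sup>2 / ((w - x) * (w - y)) - 1 \<partial>\<mu> s)"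

lemma field_diff:
  assumes "s \<ge> 0" "norm x < 1" "norm y < 1"
  shows "x * herglotz s x - y * herglotz s y = (x - y) * slope s x y"
proof -
  have "x * herglotz s x - y * herglotz s y
      = (\<integral>w. x * ((w + x) / (w - x)) - y * ((w + y) / (w - y)) \<partial>\<mu> s)"
    unfolding herglotz_def using assms unit_minus_nonzero
    by (subst Bochner_Integration.integral_diff)
       (auto intro!: integrable_circle continuous_intros simp del: times_divide_eq_right)
  also have "\<dots> = (\<integral>w. (x - y) * (2 * w\<^sup>2 / ((w - x) * (w - y)) - 1) \<partial>\<mu> s)"
  proof (rule Bochner_Integration.integral_cong[OF refl])
    fix w assume "w \<in> space (\<mu> s)"
    then have "norm w = 1" using circle_measures_space[OF circle] assms by auto
    then have "w - x \<noteq> 0" "w - y \<noteq> 0" using assms unit_minus_nonzero by blast+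
    then show "x * ((w + x) / (w - x)) - y * ((w + y) / (w - y))
        = (x - y) * (2 * w\<^sup>2 / ((w - x) * (w - y)) - 1)"
      by (simp add: divide_simps) (simp add: algebra_simps power2_eq_square)
  qed
  finally show ?thesis by (simp add: slope_def)
qed

lemma slope_0: 
  assumes "s \<ge> 0" "norm x < 1"
  shows "slope s x 0 = herglotz s x"
  unfolding slope_def herglotz_def
proof (rule Bochner_Integration.integral_cong[OF refl])
  fix w assume "w \<in> space (\<mu> s)"
  then have "norm w = 1" using circle_measures_space[OF circle] assms by auto
  moreover then have "w - x \<noteq> 0" "w \<noteq> 0" using assms unit_minus_nonzero by auto
  ultimately show "2 * w\<^sup>2 / ((w - x) * (w - 0)) - 1 = (w + x) / (w - x)"
    by (simp add: divide_simps power2_eq_square)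
qed

lemma norm_herglotz_le:
  assumes "s \<ge> 0" "norm x \<le> \<rho>" "\<rho> < 1"
  shows "norm (herglotz s x) \<le> 2 / (1 - \<rho>) * M"
  unfolding herglotz_def
proof (rule norm_integral_le[OF assms(1)])
  show "continuous_on (sphere 0 1) (\<lambda>w. (w + x) / (w - x))"
    using assms unit_minus_nonzero by (auto intro!: continuous_intros)
  fix w :: complex assume w: "norm w = 1"
  have "norm (w + x) \<le> 2" using norm_triangle_ineq[of w x] w assms by simp
  then show "norm ((w + x) / (w - x)) \<le> 2 / (1 - \<rho>)"
    unfolding norm_divide using assms norm_unit_minus_ge[OF w assms(2)] by (intro frac_le) auto
qed

lemma norm_slope_le:
  assumes "s \<ge> 0" "norm x \<le> \<rho>" "norm y \<le> \<rho>" "\<rho> < 1"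
  shows "norm (slope s x y) \<le> (2 / (1 - \<rho>)\<^sup>2 + 1) * M"
  unfolding slope_def
proof (rule norm_integral_le[OF assms(1)])
  show "continuous_on (sphere 0 1) (\<lambda>w. 2 * w\<^sup>2 / ((w - x) * (w - y)) - 1)"
    using assms unit_minus_nonzero by (auto intro!: continuous_intros)
  fix w :: complex assume w: "norm w = 1"
  have "norm (2 * w\<^sup>2 / ((w - x) * (w - y))) = 2 / (norm (w - x) * norm (w - y))"
    using w by (simp add: norm_divide norm_mult norm_power)
  also have "\<dots> \<le> 2 / (1 - \<rho>)\<^sup>2"
    unfolding power2_eq_square using assms norm_unit_minus_ge[OF w]
    by (intro divide_left_mono mult_mono mult_pos_pos) (force simp: w unit_minus_nonzero)+
  finally show "norm (2 * w\<^sup>2 / ((w - x) * (w - y)) - 1) \<le> 2 / (1 - \<rho>)\<^sup>2 + 1"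
    using norm_triangle_ineq4[of "2 * w\<^sup>2 / ((w - x) * (w - y))" 1] by simp
qed

lemma herglotz_lipschitz:
  assumes "s \<ge> 0" "norm x \<le> \<rho>" "norm y \<le> \<rho>" "\<rho> < 1"
  shows "norm (herglotz s x - herglotz s y) \<le> 2 / (1 - \<rho>)\<^sup>2 * M * norm (x - y)"
proof -
  have "herglotz s x - herglotz s y = (\<integral>w. (w + x) / (w - x) - (w + y) / (w - y) \<partial>\<mu> s)"
    unfolding herglotz_def using assms unit_minus_nonzero
    by (subst Bochner_Integration.integral_diff) (auto intro!: integrable_circle continuous_intros)
  also have "norm \<dots> \<le> (2 / (1 - \<rho>)\<^sup>2 * norm (x - y)) * M"
  proof (rule norm_integral_le[OF assms(1)])
    show "continuous_on (sphere 0 1) (\<lambda>w. (w + x) / (w - x) - (w + y) / (w - y))"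
      using assms unit_minus_nonzero by (auto intro!: continuous_intros)
    fix w :: complex assume w: "norm w = 1"
    have nz: "w - x \<noteq> 0" "w - y \<noteq> 0" using assms w unit_minus_nonzero by auto
    have "(w + x) / (w - x) - (w + y) / (w - y) = 2 * w * (x - y) / ((w - x) * (w - y))"
      using nz by (simp add: divide_simps) (simp add: algebra_simps power2_eq_square)
    also have "norm \<dots> = 2 / (norm (w - x) * norm (w - y)) * norm (x - y)"
      using w by (simp add: norm_divide norm_mult)
    also have "\<dots> \<le> 2 / (1 - \<rho>)\<^sup>2 * norm (x - y)"
      unfolding power2_eq_square using assms norm_unit_minus_ge[OF w]
      by (intro mult_right_mono divide_left_mono mult_mono mult_pos_pos) (force simp: w unit_minus_nonzero)+
    finally show "norm ((w + x) / (w - x) - (w + y) / (w - y)) \<le> 2 / (1 - \<rho>)\<^sup>2 * norm (x - y)" .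
  qed
  finally show ?thesis by (simp add: mult_ac)
qed

lemma slope_lipschitz:
  assumes "s \<ge> 0" "norm x \<le> \<rho>" "norm x' \<le> \<rho>" "norm y \<le> \<rho>" "\<rho> < 1"
  shows "norm (slope s x y - slope s x' y) \<le> 2 / (1 - \<rho>) ^ 3 * M * norm (x - x')"
proof -
  have "slope s x y - slope s x' y
     = (\<integral>w. (2 * w\<^sup>2 / ((w - x) * (w - y)) - 1) - (2 * w\<^sup>2 / ((w - x') * (w - y)) - 1) \<partial>\<mu> s)"
    unfolding slope_def using assms unit_minus_nonzero
    by (subst Bochner_Integration.integral_diff) (auto intro!: integrable_circle continuous_intros)
  also have "norm \<dots> \<le> (2 / (1 - \<rho>) ^ 3 * norm (x - x')) * M"
  proof (rule norm_integral_le[OF assms(1)])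
    show "continuous_on (sphere 0 1)
        (\<lambda>w. (2 * w\<^sup>2 / ((w - x) * (w - y)) - 1) - (2 * w\<^sup>2 / ((w - x') * (w - y)) - 1))"
      using assms unit_minus_nonzero by (auto intro!: continuous_intros)
    fix w :: complex assume w: "norm w = 1"
    have nz: "w - x \<noteq> 0" "w - x' \<noteq> 0" "w - y \<noteq> 0" using assms w unit_minus_nonzero by auto
    have "(2 * w\<^sup>2 / ((w - x) * (w - y)) - 1) - (2 * w\<^sup>2 / ((w - x') * (w - y)) - 1)
        = 2 * w\<^sup>2 * (x - x') / ((w - x) * (w - x') * (w - y))"
      using nz by (simp add: divide_simps) (simp add: algebra_simps power2_eq_square)
    also have "norm \<dots> = 2 / (norm (w - x) * norm (w - x') * norm (w - y)) * norm (x - x')"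
      using w by (simp add: norm_divide norm_mult norm_power)
    also have "\<dots> \<le> 2 / (1 - \<rho>) ^ 3 * norm (x - x')"
      unfolding power3_eq_cube using assms norm_unit_minus_ge[OF w]
      by (intro mult_right_mono divide_left_mono mult_mono mult_pos_pos mult_nonneg_nonneg)
         (force simp: w unit_minus_nonzero)+
    finally show "norm ((2 * w\<^sup>2 / ((w - x) * (w - y)) - 1) - (2 * w\<^sup>2 / ((w - x') * (w - y)) - 1))
        \<le> 2 / (1 - \<rho>) ^ 3 * norm (x - x')" .
  qed
  finally show ?thesis by (simp add: mult_ac)
qed

lemma Re_herglotz_nonneg:
  assumes "s \<ge> 0" "norm x < 1"
  shows "0 \<le> Re (herglotz s x)"
proof -
  have "Re (herglotz s x) = (\<integral>w. Re ((w + x) / (w - x)) \<partial>\<mu> s)"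
    unfolding herglotz_def using assms unit_minus_nonzero
    by (subst integral_Re[symmetric]) (auto intro!: integrable_circle continuous_intros)
  also have "\<dots> \<ge> 0"
  proof (rule integral_nonneg_AE, rule AE_I2)
    fix w assume "w \<in> space (\<mu> s)"
    then have "norm w = 1" using circle_measures_space[OF circle] assms by auto
    then show "0 \<le> Re ((w + x) / (w - x))" using assms by (intro Re_cayley_nonneg) auto
  qed
  finally show ?thesis .
qed

text \<open>Regularity in time along continuous paths in the disk; a path has compact range, so the kernel
  stays away from its pole on the circle.\<close>

lemma along_path:
  assumes h: "continuous_on {0..b} h" "h ` {0..b} \<subseteq> ball 0 1"
  shows herglotz_integrable_on: "(\<lambda>s. herglotz s (h s)) integrable_on {0..b}"
    and continuous_herglotz: "s \<in> {0..b} \<Longrightarrow> weakly_continuous_at \<mu> s \<Longrightarrow>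
      continuous (at s within {0..b}) (\<lambda>s. herglotz s (h s))"
proof -
  have nz: "w - h s \<noteq> 0" if "s \<in> {0..b}" "norm w = 1" for s w
    using unit_minus_nonzero(1) h(2) that by force
  have "continuous_on ({0..b} \<times> sphere 0 1) (\<lambda>x. (snd x + h (fst x)) / (snd x - h (fst x)))"
    by (intro continuous_intros continuous_on_compose2[OF h(1)]) (use nz in auto)
  then have k: "continuous_on ({0..b} \<times> sphere 0 1) (\<lambda>(s, w). (w + h s) / (w - h s))"
    by (simp add: case_prod_unfold)
  show "(\<lambda>s. herglotz s (h s)) integrable_on {0..b}"
    unfolding herglotz_def by (rule integrable_on_integral[OF k])
  show "continuous (at s within {0..b}) (\<lambda>s. herglotz s (h s))"
    if "s \<in> {0..b}" "weakly_continuous_at \<mu> s"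
    unfolding herglotz_def by (rule continuous_within_integral[OF k that])
qed

lemma along_two_paths:
  assumes h: "continuous_on {0..b} h" "h ` {0..b} \<subseteq> ball 0 1"
    and h': "continuous_on {0..b} h'" "h' ` {0..b} \<subseteq> ball 0 1"
  shows slope_integrable_on: "(\<lambda>s. slope s (h s) (h' s)) integrable_on {0..b}"
    and continuous_slope: "s \<in> {0..b} \<Longrightarrow> weakly_continuous_at \<mu> s \<Longrightarrow>
      continuous (at s within {0..b}) (\<lambda>s. slope s (h s) (h' s))"
proof -
  have nz: "w - h s \<noteq> 0" "w - h' s \<noteq> 0" if "s \<in> {0..b}" "norm w = 1" for s w
    using unit_minus_nonzero(1)[of w] h(2) h'(2) that by force+
  have "continuous_on ({0..b} \<times> sphere 0 1)
      (\<lambda>x. 2 * (snd x)\<^sup>2 / ((snd x - h (fst x)) * (snd x - h' (fst x))) - 1)"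
    by (intro continuous_intros continuous_on_compose2[OF h(1)] continuous_on_compose2[OF h'(1)])
       (use nz in auto)
  then have k: "continuous_on ({0..b} \<times> sphere 0 1)
      (\<lambda>(s, w). 2 * w\<^sup>2 / ((w - h s) * (w - h' s)) - 1)"
    by (simp add: case_prod_unfold)
  show "(\<lambda>s. slope s (h s) (h' s)) integrable_on {0..b}"
    unfolding slope_def by (rule integrable_on_integral[OF k])
  show "continuous (at s within {0..b}) (\<lambda>s. slope s (h s) (h' s))"
    if "s \<in> {0..b}" "weakly_continuous_at \<mu> s"
    unfolding slope_def by (rule continuous_within_integral[OF k that])
qed

section \<open>Uniqueness and monotonicity of solutions\<close>

text \<open>The equation is imposed inside the interval, where the derivative is two-sided: that is the form
  in which the fundamental theorem of calculus uses it.\<close>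

definition trajectory :: "real \<Rightarrow> (real \<Rightarrow> complex) \<Rightarrow> bool" where
  "trajectory t g \<longleftrightarrow> continuous_on {0..t} g \<and> g ` {0..t} \<subseteq> ball 0 1 \<and>
    (\<forall>s\<in>{0<..<t}. weakly_continuous_at \<mu> s \<longrightarrow>
      (g has_vector_derivative g s * herglotz s (g s)) (at s))"

lemma trajectory_norm_less: "trajectory t g \<Longrightarrow> s \<in> {0..t} \<Longrightarrow> norm (g s) < 1"
  by (auto simp: trajectory_def image_subset_iff)

lemma loewner_solution_trajectory:
  assumes "loewner_solution \<mu> z T g" "ereal t < T"
  shows "trajectory t g"
proof -
  have le: "ereal s < T" if "s \<le> t" for s
    using assms(2) that by (meson ereal_less_eq(3) order_le_less_trans)
  have "continuous_on {0..t} g"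
    using assms(1) le by (auto simp: loewner_solution_def elim!: continuous_on_subset)
  moreover have "g s \<in> ball 0 1" if "s \<in> {0..t}" for s
    using assms(1) le[of s] that by (auto simp: loewner_solution_def)
  moreover have "(g has_vector_derivative g s * herglotz s (g s)) (at s)"
    if "s \<in> {0<..<t}" "weakly_continuous_at \<mu> s" for s
  proof -
    have "(g has_vector_derivative g s * herglotz s (g s)) (at s within {0..})"
      using assms(1) le[of s] that unfolding loewner_solution_def herglotz_def by auto
    moreover have "at s within {0..} = at s"
      using that by (intro at_within_interior) auto
    ultimately show ?thesis by simp
  qed
  ultimately show ?thesis unfolding trajectory_def by blast
qed

text \<open>By \<open>field_diff\<close> the difference of two solutions solves the linear equation with coefficient
  \<open>slope s (g s) (h s)\<close>. As the exponential never vanishes, two solutions that meet once agree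
  throughout.\<close>

lemma trajectory_diff:
  assumes g: "trajectory t g" and h: "trajectory t h" and s: "s \<in> {0..t}"
  shows "g s - h s = (g 0 - h 0) * exp (integral {0..s} (\<lambda>u. slope u (g u) (h u)))"
proof (rule linear_ode_finite_exceptions[OF finite_jumps[of t] _ _ _ _ s])
  note gh = g[unfolded trajectory_def] h[unfolded trajectory_def]
  show "continuous_on {0..t} (\<lambda>s. g s - h s)" using gh by (intro continuous_intros) auto
  show "(\<lambda>u. slope u (g u) (h u)) integrable_on {0..t}"
    using gh by (intro slope_integrable_on) auto
  show "continuous (at s within {0..t}) (\<lambda>u. slope u (g u) (h u))"
    if "s \<in> {0..t} - {s \<in> {0..t}. \<not> weakly_continuous_at \<mu> s}" for s
    using gh that by (intro continuous_slope) auto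
  show "((\<lambda>s. g s - h s) has_vector_derivative (g s - h s) * slope s (g s) (h s)) (at s)"
    if "s \<in> {0<..<t} - {s \<in> {0..t}. \<not> weakly_continuous_at \<mu> s}" for s
    using gh that trajectory_norm_less[OF g, of s] trajectory_norm_less[OF h, of s]
    by (subst field_diff[symmetric]) (auto intro!: has_vector_derivative_diff)
qed

lemma trajectory_eqI:
  assumes "trajectory t g" "trajectory t h" "r \<in> {0..t}" "g r = h r" "s \<in> {0..t}"
  shows "g s = h s"
  using trajectory_diff[OF assms(1,2), of r] trajectory_diff[OF assms(1,2), of s] assms(3-5)
  by simp

lemma trajectory_zero: "trajectory t (\<lambda>_. 0)"
  by (auto simp: trajectory_def)

text \<open>Comparison with the zero solution: the coefficient in \<open>trajectory_diff\<close> is then \<open>herglotz s (g s)\<close>,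
  whose real part is nonnegative.\<close>

lemma trajectory_norm_mono:
  assumes g: "trajectory t g" and s: "s \<in> {0..t}"
  shows "norm (g s) \<le> norm (g t)"
proof -
  have t: "t \<in> {0..t}" using s by auto
  let ?p = "\<lambda>u. slope u (g u) 0"
  have int: "?p integrable_on {0..t}"
    using g by (intro slope_integrable_on) (auto simp: trajectory_def)
  have "integral {0..s} ?p + integral {s..t} ?p = integral {0..t} ?p"
    using s by (intro Henstock_Kurzweil_Integration.integral_combine int) auto
  moreover have "0 \<le> Re (integral {s..t} ?p)"
  proof -
    have "?p integrable_on {s..t}" by (rule integrable_subinterval_real[OF int]) (use s in auto)
    then have "((\<lambda>u. Re (?p u)) has_integral Re (integral {s..t} ?p)) {s..t}"
      using has_integral_Re by blast
    then show ?thesis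
      by (rule has_integral_nonneg)
         (use s trajectory_norm_less[OF g] in \<open>auto simp: slope_0 intro!: Re_herglotz_nonneg\<close>)
  qed
  ultimately have "Re (integral {0..s} ?p) \<le> Re (integral {0..t} ?p)"
    by (metis add_increasing2 order_refl plus_complex.sel(1))
  then show ?thesis
    using trajectory_diff[OF g trajectory_zero s] trajectory_diff[OF g trajectory_zero t]
    by (simp add: norm_mult mult_left_mono)
qed

section \<open>Existence with a prescribed value at time t\<close>

text \<open>Along a solution, \<open>action\<close> is the increment of \<open>log g\<close> since time \<open>0\<close>.\<close>

definition action :: "(real \<Rightarrow> complex) \<Rightarrow> real \<Rightarrow> complex" where
  "action g s = integral {0..s} (\<lambda>u. herglotz u (g u))"

lemma action_diff:
  assumes g: "continuous_on {0..T} g" "g ` {0..T} \<subseteq> ball 0 1" and "0 \<le> r" "r \<le> s" "s \<le> T"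
  shows "((\<lambda>u. herglotz u (g u)) has_integral (action g s - action g r)) {r..s}"
proof -
  have int: "(\<lambda>u. herglotz u (g u)) integrable_on {0..T}"
    by (rule herglotz_integrable_on[OF g])
  have "(\<lambda>u. herglotz u (g u)) integrable_on {0..s}" "(\<lambda>u. herglotz u (g u)) integrable_on {r..s}"
    by (rule integrable_subinterval_real[OF int]; use assms in auto)+
  moreover then have "action g r + integral {r..s} (\<lambda>u. herglotz u (g u)) = action g s"
    unfolding action_def using assms by (intro Henstock_Kurzweil_Integration.integral_combine) auto
  ultimately show ?thesis by (metis add_diff_cancel_left' integrable_integral)
qed

lemma has_integral_exp_mult:
  fixes c :: real
  assumes "a \<le> b" "c \<noteq> 0"
  shows "((\<lambda>u. exp (c * u)) has_integral (exp (c * b) - exp (c * a)) / c) {a..b}"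
proof -
  have "((\<lambda>u. exp (c * u) / c) has_real_derivative exp (c * x)) (at x within {a..b})" for x
    using assms by (auto intro!: derivative_eq_intros)
  from fundamental_theorem_of_calculus[OF assms(1) this[unfolded has_real_derivative_iff_has_vector_derivative]]
  show ?thesis by (simp add: diff_divide_distrib)
qed

text \<open>Weighted norms make the Picard map a contraction on an interval of any length: integrating the
  weight \<open>exp (2 L |u - t|)\<close> from \<open>t\<close> gains a factor \<open>1 / (2 L)\<close>, which beats the Lipschitz constant \<open>L\<close>
  by a factor of two. The weight is centred at \<open>t\<close> because the initial condition is given there.\<close>

lemma action_contraction:
  assumes g: "continuous_on {0..T} g" "g ` {0..T} \<subseteq> cball 0 \<rho>"
    and h: "continuous_on {0..T} h" "h ` {0..T} \<subseteq> cball 0 \<rho>"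
    and \<rho>: "\<rho> < 1" and t: "t \<in> {0..T}" and s: "s \<in> {0..T}"
    and L: "2 / (1 - \<rho>)\<^sup>2 * M \<le> L" "0 < L"
    and gh: "\<And>u. u \<in> {0..T} \<Longrightarrow> norm (g u - h u) \<le> D * exp (2 * L * \<bar>u - t\<bar>)"
  shows "norm ((action g s - action g t) - (action h s - action h t)) \<le> D / 2 * exp (2 * L * \<bar>s - t\<bar>)"
proof -
  have ball: "g ` {0..T} \<subseteq> ball 0 1" "h ` {0..T} \<subseteq> ball 0 1"
    using g(2) h(2) \<rho> by force+
  have D: "0 \<le> D"
  proof -
    have "norm (g t - h t) \<le> D" using gh[OF t] by simp
    then show ?thesis by (meson norm_ge_zero order_trans)
  qed
  have bound: "norm (herglotz u (g u) - herglotz u (h u)) \<le> L * D * exp (2 * L * \<bar>u - t\<bar>)"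
    if "u \<in> {0..T}" for u
  proof -
    have "norm (herglotz u (g u) - herglotz u (h u)) \<le> 2 / (1 - \<rho>)\<^sup>2 * M * norm (g u - h u)"
      using g(2) h(2) that \<rho> by (intro herglotz_lipschitz) force+
    also have "\<dots> \<le> L * (D * exp (2 * L * \<bar>u - t\<bar>))"
      using L gh[OF that] by (intro mult_mono) auto
    finally show ?thesis by (simp add: mult_ac)
  qed
  have diff: "((\<lambda>u. herglotz u (g u) - herglotz u (h u)) has_integral
      (action g b - action g a) - (action h b - action h a)) {a..b}" if "0 \<le> a" "a \<le> b" "b \<le> T" for a b
    by (intro has_integral_diff action_diff[OF g(1) ball(1)] action_diff[OF h(1) ball(2)] that)
  have key: "norm ((action g b - action g a) - (action h b - action h a)) \<le> I"
    if ab: "0 \<le> a" "a \<le> b" "b \<le> T" and f: "(f has_integral I) {a..b}"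
      and le: "\<And>u. u \<in> {a..b} \<Longrightarrow> L * D * exp (2 * L * \<bar>u - t\<bar>) \<le> f u" for a b f I
  proof -
    have "norm (integral {a..b} (\<lambda>u. herglotz u (g u) - herglotz u (h u))) \<le> integral {a..b} f"
      using diff[OF ab] f ab bound le
      by (intro integral_norm_bound_integral) (auto intro: order_trans simp: has_integral_iff)
    then show ?thesis using integral_unique[OF diff[OF ab]] integral_unique[OF f] by simp
  qed
  show ?thesis
  proof (cases "t \<le> s")
    case True
    have "((\<lambda>u. L * D * exp (- 2 * L * t) * exp (2 * L * u)) has_integral
        L * D * exp (- 2 * L * t) * ((exp (2 * L * s) - exp (2 * L * t)) / (2 * L))) {t..s}"
      using True L by (intro has_integral_mult_right has_integral_exp_mult) auto
    from key[OF _ True _ this]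
    have "norm ((action g s - action g t) - (action h s - action h t))
        \<le> L * D * exp (- 2 * L * t) * ((exp (2 * L * s) - exp (2 * L * t)) / (2 * L))"
      using t s by (auto simp: algebra_simps simp flip: exp_add)
    also have "\<dots> = D / 2 * (exp (2 * L * (s - t)) - 1)"
      using L by (simp add: field_simps flip: exp_add)
    also have "\<dots> \<le> D / 2 * exp (2 * L * \<bar>s - t\<bar>)"
      using True D by (simp add: algebra_simps)
    finally show ?thesis .
  next
    case False
    have "((\<lambda>u. L * D * exp (2 * L * t) * exp (- 2 * L * u)) has_integral
        L * D * exp (2 * L * t) * ((exp (- 2 * L * t) - exp (- 2 * L * s)) / (- 2 * L))) {s..t}"
      using False L by (intro has_integral_mult_right has_integral_exp_mult) auto
    from key[OF _ _ _ this]
    have "norm ((action g t - action g s) - (action h t - action h s))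
        \<le> L * D * exp (2 * L * t) * ((exp (- 2 * L * t) - exp (- 2 * L * s)) / (- 2 * L))"
      using t s False by (auto simp: algebra_simps simp flip: exp_add)
    also have "\<dots> = D / 2 * (exp (2 * L * (t - s)) - 1)"
      using L by (simp add: field_simps flip: exp_add)
    also have "\<dots> \<le> D / 2 * exp (2 * L * \<bar>s - t\<bar>)"
      using False D by (simp add: algebra_simps)
    finally show ?thesis by (simp add: norm_minus_commute algebra_simps)
  qed
qed

definition picard :: "complex \<Rightarrow> real \<Rightarrow> (real \<Rightarrow> complex) \<Rightarrow> real \<Rightarrow> complex" where
  "picard w t g s = w * exp (action g s - action g t)"

text \<open>Invariance of the closed disk. Before time \<open>t\<close> the exponent has nonpositive real part, so the
  modulus is at most that of \<open>w\<close>; after time \<open>t\<close> the modulus can grow, but the bound on the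
  field and the choice of \<open>T\<close> keep it below \<open>\<rho>\<close>.\<close>

lemma norm_picard_le:
  assumes g: "continuous_on {0..T} g" "g ` {0..T} \<subseteq> cball 0 \<rho>"
    and \<rho>: "\<rho> < 1" and t: "t \<in> {0..T}" and s: "s \<in> {0..T}"
    and T: "norm w * exp (2 / (1 - \<rho>) * M * (T - t)) \<le> \<rho>"
  shows "norm (picard w t g s) \<le> \<rho>"
proof -
  have ball: "g ` {0..T} \<subseteq> ball 0 1" using g(2) \<rho> by force
  have "Re (action g s - action g t) \<le> 2 / (1 - \<rho>) * M * (T - t)"
  proof (cases "s \<le> t")
    case True
    have "((\<lambda>u. Re (herglotz u (g u))) has_integral Re (action g t - action g s)) {s..t}"
      using s t True by (intro has_integral_Re action_diff[OF g(1) ball]) auto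
    then have "0 \<le> Re (action g t - action g s)"
      by (rule has_integral_nonneg) (use s t ball in \<open>auto intro!: Re_herglotz_nonneg simp: image_subset_iff\<close>)
    moreover have "0 \<le> 2 / (1 - \<rho>) * M * (T - t)"
      using \<rho> t M_nonneg by auto
    ultimately show ?thesis by simp
  next
    case False
    have bound: "norm (herglotz u (g u)) \<le> 2 / (1 - \<rho>) * M" if "u \<in> {0..T}" for u
      using g(2) that \<rho> by (intro norm_herglotz_le) (auto simp: image_subset_iff)
    have "norm (action g s - action g t)
        \<le> 2 / (1 - \<rho>) * M * Henstock_Kurzweil_Integration.content {t..s}"
      by (rule has_integral_bound_real[OF _ finite.emptyI action_diff[OF g(1) ball]])
         (use s t False \<rho> M_nonneg bound in auto)
    then have "norm (action g s - action g t) \<le> 2 / (1 - \<rho>) * M * (s - t)"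
      using False by simp
    also have "\<dots> \<le> 2 / (1 - \<rho>) * M * (T - t)"
      using \<rho> s M_nonneg by (intro mult_left_mono) auto
    finally show ?thesis using complex_Re_le_cmod order_trans by blast
  qed
  then have "norm (picard w t g s) \<le> norm w * exp (2 / (1 - \<rho>) * M * (T - t))"
    by (simp add: picard_def norm_mult mult_left_mono)
  with T show ?thesis by linarith
qed

lemma continuous_on_picard:
  assumes g: "continuous_on {0..T} g" "g ` {0..T} \<subseteq> ball 0 1"
  shows "continuous_on {0..T} (picard w t g)"
  unfolding picard_def action_def
  by (intro continuous_intros indefinite_integral_continuous_1 herglotz_integrable_on[OF g])

text \<open>Passing from the exponents to the exponentials costs a factor \<open>norm w * exp c\<close>, where \<open>c\<close> is the
  larger of the two real parts. That factor is the modulus of one of the two values of \<open>picard\<close>, so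
  it is at most \<open>\<rho> < 1\<close>.\<close>

lemma picard_contraction:
  assumes g: "continuous_on {0..T} g" "g ` {0..T} \<subseteq> cball 0 \<rho>"
    and h: "continuous_on {0..T} h" "h ` {0..T} \<subseteq> cball 0 \<rho>"
    and \<rho>: "\<rho> < 1" and t: "t \<in> {0..T}" and s: "s \<in> {0..T}"
    and T: "norm w * exp (2 / (1 - \<rho>) * M * (T - t)) \<le> \<rho>"
    and L: "2 / (1 - \<rho>)\<^sup>2 * M \<le> L" "0 < L"
    and gh: "\<And>u. u \<in> {0..T} \<Longrightarrow> norm (g u - h u) \<le> D * exp (2 * L * \<bar>u - t\<bar>)"
  shows "norm (picard w t g s - picard w t h s) \<le> D / 2 * exp (2 * L * \<bar>s - t\<bar>)"
proof -
  let ?a = "action g s - action g t" and ?b = "action h s - action h t"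
  define c where "c = max (Re ?a) (Re ?b)"
  have c: "norm w * exp c \<le> \<rho>"
    using norm_picard_le[OF g \<rho> t s T] norm_picard_le[OF h \<rho> t s T]
    by (auto simp: picard_def norm_mult c_def max_def)
  have "picard w t g s - picard w t h s = w * (exp ?a - exp ?b)"
    by (simp add: picard_def algebra_simps)
  then have "norm (picard w t g s - picard w t h s) = norm w * norm (exp ?a - exp ?b)"
    by (simp add: norm_mult)
  also have "\<dots> \<le> norm w * (exp c * norm (?a - ?b))"
    by (intro mult_left_mono norm_exp_diff_le) (auto simp: c_def)
  also have "\<dots> = (norm w * exp c) * norm (?a - ?b)" by simp
  also have "\<dots> \<le> 1 * norm (?a - ?b)"
    using c \<rho> by (intro mult_right_mono) auto
  also have "\<dots> \<le> D / 2 * exp (2 * L * \<bar>s - t\<bar>)"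
    using action_contraction[OF g h \<rho> t s L gh] by simp
  finally show ?thesis .
qed

lemma picard_fixed_point:
  assumes "norm w < 1" and t: "0 \<le> t"
  obtains T g where "t < T" "continuous_on {0..T} g" "g ` {0..T} \<subseteq> ball 0 1"
    "\<And>s. s \<in> {0..T} \<Longrightarrow> g s = picard w t g s"
proof -
  define \<rho> where "\<rho> = (1 + norm w) / 2"
  have \<rho>: "norm w < \<rho>" "\<rho> < 1" using assms by (auto simp: \<rho>_def)
  have "((\<lambda>T. norm w * exp (2 / (1 - \<rho>) * M * (T - t))) \<longlongrightarrow> norm w * exp (2 / (1 - \<rho>) * M * (t - t))) (at_right t)"
    by (intro tendsto_intros)
  then have "\<forall>\<^sub>F T in at_right t. norm w * exp (2 / (1 - \<rho>) * M * (T - t)) < \<rho>"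
    using \<rho> by (intro order_tendstoD(2)) auto
  then have "\<forall>\<^sub>F T in at_right t. t < T \<and> norm w * exp (2 / (1 - \<rho>) * M * (T - t)) < \<rho>"
    by (intro eventually_conj eventually_at_right_less)
  then obtain T where "t < T" and T: "norm w * exp (2 / (1 - \<rho>) * M * (T - t)) \<le> \<rho>"
    using eventually_happens'[of "at_right t"] by (force simp: less_imp_le)
  have tT: "t \<in> {0..T}" using \<open>t < T\<close> t by simp
  define L where "L = 2 / (1 - \<rho>)\<^sup>2 * M + 1"
  have L: "2 / (1 - \<rho>)\<^sup>2 * M \<le> L" "0 < L"
    using M_nonneg by (auto simp: L_def intro!: add_nonneg_pos)
  define h where "h n = (picard w t ^^ n) (\<lambda>_. w)" for n
  have h_Suc: "h (Suc n) = picard w t (h n)" for n by (simp add: h_def)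
  have ball: "f ` {0..T} \<subseteq> ball 0 1" if "f ` {0..T} \<subseteq> cball 0 \<rho>" for f :: "real \<Rightarrow> complex"
    using that \<rho> by force
  have h: "continuous_on {0..T} (h n) \<and> h n ` {0..T} \<subseteq> cball 0 \<rho>" for n
  proof (induction n)
    case 0
    then show ?case using \<rho> by (auto simp: h_def)
  next
    case (Suc n)
    then show ?case
      using norm_picard_le[OF _ _ \<rho>(2) tT _ T, of "h n"] continuous_on_picard[of T "h n"] ball[of "h n"]
      by (auto simp: h_Suc)
  qed
  have contr: "norm (picard w t (h n) s - picard w t g s) \<le> D / 2 * exp (2 * L * \<bar>s - t\<bar>)"
    if "s \<in> {0..T}" "continuous_on {0..T} g" "g ` {0..T} \<subseteq> cball 0 \<rho>"
      "\<And>u. u \<in> {0..T} \<Longrightarrow> norm (h n u - g u) \<le> D * exp (2 * L * \<bar>u - t\<bar>)" for n g s D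
    using h[of n] that by (intro picard_contraction[OF _ _ _ _ \<rho>(2) tT _ T L]) auto
  have step: "norm (h (Suc n) s - h n s) \<le> 2 * (1 / 2) ^ n * exp (2 * L * \<bar>s - t\<bar>)"
    if "s \<in> {0..T}" for n s
    using that
  proof (induction n arbitrary: s)
    case 0
    have "norm (h 1 s - h 0 s) \<le> norm (h 1 s) + norm (h 0 s)" by (rule norm_triangle_ineq4)
    also have "\<dots> \<le> 1 + 1"
      using h[of 1] h[of 0] 0 \<rho> by (intro add_mono) (force simp: image_subset_iff)+
    also have "\<dots> \<le> 2 * exp (2 * L * \<bar>s - t\<bar>)" using L by simp
    finally show ?case by simp
  next
    case (Suc n)
    have "norm (picard w t (h (Suc n)) s - picard w t (h n) s)
        \<le> (2 * (1 / 2) ^ n) / 2 * exp (2 * L * \<bar>s - t\<bar>)"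
      using Suc h[of n] by (intro contr) auto
    then show ?case by (simp add: h_Suc)
  qed
  \<comment> \<open>On \<open>{0..T}\<close> the weight lies between \<open>1\<close> and \<open>E\<close>, so weighted and uniform convergence agree.\<close>
  define E where "E = exp (2 * L * T)"
  have E: "exp (2 * L * \<bar>s - t\<bar>) \<le> E" if "s \<in> {0..T}" for s
    using that tT L by (auto simp: E_def)
  have "uniformly_convergent_on {0..T} (\<lambda>n s. \<Sum>i<n. h (Suc i) s - h i s)"
  proof (rule Weierstrass_m_test')
    show "norm (h (Suc n) s - h n s) \<le> 2 * E * (1 / 2) ^ n" if "s \<in> {0..T}" for n s
    proof -
      have "norm (h (Suc n) s - h n s) \<le> 2 * (1 / 2) ^ n * exp (2 * L * \<bar>s - t\<bar>)"
        by (rule step[OF that])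
      also have "\<dots> \<le> 2 * (1 / 2) ^ n * E" by (intro mult_left_mono E that) auto
      finally show ?thesis by (simp add: mult_ac)
    qed
    show "summable (\<lambda>n. 2 * E * (1 / 2) ^ n)" by (intro summable_mult summable_geometric) auto
  qed
  then obtain l where "uniform_limit {0..T} (\<lambda>n s. \<Sum>i<n. h (Suc i) s - h i s) l sequentially"
    by (auto simp: uniformly_convergent_on_def)
  moreover have "(\<Sum>i<n. h (Suc i) s - h i s) = h n s - h 0 s" for n s
    by (rule sum_lessThan_telescope)
  ultimately have "uniform_limit {0..T} (\<lambda>n s. h n s - h 0 s) l sequentially" by simp
  then have "uniform_limit {0..T} (\<lambda>n s. (h n s - h 0 s) + h 0 s) (\<lambda>s. l s + h 0 s) sequentially"
    by (intro uniform_limit_intros)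
  then obtain g where g_lim: "uniform_limit {0..T} h g sequentially"
    by simp
  have g_pt: "(\<lambda>n. h n s) \<longlonglongrightarrow> g s" if "s \<in> {0..T}" for s
    by (rule tendsto_uniform_limitI[OF g_lim that])
  have g_cont: "continuous_on {0..T} g"
    using h by (intro uniform_limit_theorem[OF _ g_lim]) auto
  have g_ball: "g ` {0..T} \<subseteq> cball 0 \<rho>"
  proof clarify
    fix s assume s: "s \<in> {0..T}"
    have "norm (g s) \<le> \<rho>"
      by (rule Lim_bounded[OF tendsto_norm[OF g_pt[OF s]], of 0]) (use h s in force)
    then show "g s \<in> cball 0 \<rho>" by simp
  qed
  have "g s = picard w t g s" if s: "s \<in> {0..T}" for s
  proof (rule LIMSEQ_unique)
    show "(\<lambda>n. h (Suc n) s) \<longlonglongrightarrow> g s" using g_pt[OF s] by (rule LIMSEQ_Suc)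
    show "(\<lambda>n. h (Suc n) s) \<longlonglongrightarrow> picard w t g s"
    proof (rule tendstoI)
      fix e :: real assume "e > 0"
      then have "\<forall>\<^sub>F n in sequentially. \<forall>u\<in>{0..T}. dist (h n u) (g u) < e / E"
        using g_lim by (auto simp: uniform_limit_iff E_def)
      then show "\<forall>\<^sub>F n in sequentially. dist (h (Suc n) s) (picard w t g s) < e"
      proof eventually_elim
        case (elim n)
        have "norm (h n u - g u) \<le> (e / E) * exp (2 * L * \<bar>u - t\<bar>)" if "u \<in> {0..T}" for u
        proof -
          have "norm (h n u - g u) \<le> (e / E) * 1"
            using elim that by (auto simp: dist_norm intro: less_imp_le)
          also have "\<dots> \<le> (e / E) * exp (2 * L * \<bar>u - t\<bar>)"
            using \<open>e > 0\<close> L by (intro mult_left_mono) (auto simp: E_def)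
          finally show ?thesis .
        qed
        then have "norm (picard w t (h n) s - picard w t g s) \<le> (e / E) / 2 * exp (2 * L * \<bar>s - t\<bar>)"
          by (intro contr s g_cont g_ball)
        also have "\<dots> \<le> (e / E) / 2 * E"
          using \<open>e > 0\<close> E[OF s] by (intro mult_left_mono) (auto simp: E_def)
        also have "\<dots> < e" using \<open>e > 0\<close> by (simp add: E_def)
        finally show ?case by (simp add: h_Suc dist_norm)
      qed
    qed
  qed
  with \<open>t < T\<close> g_cont ball[OF g_ball] show thesis by (rule that)
qed

text \<open>Differentiating the fixed point equation at a time of weak continuity recovers the Loewner
  equation. The lifetime exceeds \<open>t\<close> strictly because the fixed point lives on a longer interval.\<close>

lemma loewner_solution_through:
  assumes "norm w < 1" "0 \<le> t"
  obtains g T where "ereal t < T" "loewner_solution \<mu> (g 0) T g" "g t = w"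
proof -
  obtain T g where tT: "t < T" and g: "continuous_on {0..T} g" "g ` {0..T} \<subseteq> ball 0 1"
    and fixed: "\<And>s. s \<in> {0..T} \<Longrightarrow> g s = picard w t g s"
    using picard_fixed_point[OF assms] by blast
  have "(g has_vector_derivative (g s * (\<integral>w. (w + g s) / (w - g s) \<partial>\<mu> s))) (at s within {0..})"
    if s: "0 \<le> s" "s < T" "weakly_continuous_at \<mu> s" for s
  proof -
    have "(action g has_vector_derivative herglotz s (g s)) (at s within {0..T})"
      using integral_has_vector_derivative_continuous_at[OF herglotz_integrable_on[OF g], of s "{}"]
        continuous_herglotz[OF g, of s] s
      by (simp add: action_def[abs_def])
    then have "((\<lambda>s. action g s - action g t) has_vector_derivative herglotz s (g s)) (at s within {0..T})"
      using has_vector_derivative_diff[OF _ has_vector_derivative_const] by fastforce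
    then have "((\<lambda>s. exp (action g s - action g t)) has_vector_derivative
        herglotz s (g s) * exp (action g s - action g t)) (at s within {0..T})"
      using field_vector_diff_chain_within[of "\<lambda>s. action g s - action g t" "herglotz s (g s)" s "{0..T}" exp,
          OF _ has_field_derivative_at_within[OF DERIV_exp]]
      by (simp add: o_def)
    then have "((\<lambda>s. w * exp (action g s - action g t)) has_vector_derivative
        w * (herglotz s (g s) * exp (action g s - action g t))) (at s within {0..T})"
      by (rule has_vector_derivative_mult_right)
    moreover have "w * (herglotz s (g s) * exp (action g s - action g t)) = g s * herglotz s (g s)"
      using fixed[of s] s by (simp add: picard_def)
    ultimately have "((\<lambda>s. w * exp (action g s - action g t)) has_vector_derivative g s * herglotz s (g s))
        (at s within {0..T})" by simp
    then have "(g has_vector_derivative g s * herglotz s (g s)) (at s within {0..T})"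
      by (rule has_vector_derivative_transform[rotated 2]) (use fixed s in \<open>auto simp: picard_def\<close>)
    moreover have "at s within {0..T} = at s within {0..}"
      by (rule at_within_nhd[of _ "{..<T}"]) (use s in auto)
    ultimately show ?thesis by (simp add: herglotz_def)
  qed
  then have "loewner_solution \<mu> (g 0) (ereal T) g"
    using g by (auto simp: loewner_solution_def image_subset_iff elim!: continuous_on_subset)
  moreover have "g t = w"
    using fixed[of t] assms tT by (simp add: picard_def)
  ultimately show thesis using that[of "ereal T" g] tT by simp
qed

section \<open>The inverse Loewner map\<close>

lemma norm_slope_integral_le:
  assumes g: "trajectory t g" "norm (g t) \<le> \<rho>" and h: "trajectory t h" "norm (h t) \<le> \<rho>"
    and \<rho>: "\<rho> < 1" and s: "s \<in> {0..t}"
  shows "norm (integral {0..s} (\<lambda>u. slope u (g u) (h u))) \<le> (2 / (1 - \<rho>)\<^sup>2 + 1) * M * t"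
proof -
  have bound: "norm (slope u (g u) (h u)) \<le> (2 / (1 - \<rho>)\<^sup>2 + 1) * M" if "u \<in> {0..t}" for u
    using trajectory_norm_mono[OF g(1) that] trajectory_norm_mono[OF h(1) that] that g h \<rho>
    by (intro norm_slope_le) auto
  have "(\<lambda>u. slope u (g u) (h u)) integrable_on {0..t}"
    using g h by (intro slope_integrable_on) (auto simp: trajectory_def)
  then have "(\<lambda>u. slope u (g u) (h u)) integrable_on {0..s}"
    by (rule integrable_subinterval_real) (use s in auto)
  then have int: "((\<lambda>u. slope u (g u) (h u)) has_integral integral {0..s} (\<lambda>u. slope u (g u) (h u))) {0..s}"
    by (rule integrable_integral)
  have "norm (integral {0..s} (\<lambda>u. slope u (g u) (h u)))
      \<le> (2 / (1 - \<rho>)\<^sup>2 + 1) * M * Henstock_Kurzweil_Integration.content {0..s}"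
    by (rule has_integral_bound_real[OF _ finite.emptyI int])
       (use s bound M_nonneg in \<open>auto intro!: mult_nonneg_nonneg add_nonneg_nonneg\<close>)
  also have "\<dots> \<le> (2 / (1 - \<rho>)\<^sup>2 + 1) * M * t"
    using s M_nonneg by (intro mult_left_mono) (auto intro!: mult_nonneg_nonneg add_nonneg_nonneg)
  finally show ?thesis .
qed

lemma trajectory_diff_le:
  assumes g: "trajectory t g" "norm (g t) \<le> \<rho>" and h: "trajectory t h" "norm (h t) \<le> \<rho>"
    and \<rho>: "\<rho> < 1" and s: "s \<in> {0..t}"
  shows "norm (g s - h s) \<le> exp (2 * ((2 / (1 - \<rho>)\<^sup>2 + 1) * M * t)) * norm (g t - h t)"
proof -
  define I where "I s = integral {0..s} (\<lambda>u. slope u (g u) (h u))" for s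
  define K where "K = (2 / (1 - \<rho>)\<^sup>2 + 1) * M * t"
  have t: "t \<in> {0..t}" using s by auto
  have "norm (I s) \<le> K" "norm (I t) \<le> K"
    unfolding I_def K_def by (intro norm_slope_integral_le g h \<rho> s t)+
  then have K: "Re (I s - I t) \<le> 2 * K"
    using norm_triangle_ineq4[of "I s" "I t"] complex_Re_le_cmod[of "I s - I t"] by linarith
  have "g s - h s = (g 0 - h 0) * exp (I s)" "g t - h t = (g 0 - h 0) * exp (I t)"
    unfolding I_def using trajectory_diff[OF g(1) h(1)] s t by blast+
  then have "g s - h s = (g t - h t) * exp (I s - I t)"
    by (simp add: exp_diff)
  then have "norm (g s - h s) = exp (Re (I s - I t)) * norm (g t - h t)"
    by (simp add: norm_mult)
  also have "\<dots> \<le> exp (2 * K) * norm (g t - h t)"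
    using K by (intro mult_right_mono) auto
  finally show ?thesis by (simp add: K_def)
qed

lemma slope_integral_lipschitz:
  assumes g: "trajectory t g" "norm (g t) \<le> \<rho>" and h: "trajectory t h" "norm (h t) \<le> \<rho>"
    and \<rho>: "\<rho> < 1" and t: "0 \<le> t"
  shows "norm (integral {0..t} (\<lambda>u. slope u (g u) (h u)) - integral {0..t} (\<lambda>u. slope u (h u) (h u)))
    \<le> 2 / (1 - \<rho>) ^ 3 * M * (exp (2 * ((2 / (1 - \<rho>)\<^sup>2 + 1) * M * t)) * norm (g t - h t)) * t"
    (is "_ \<le> ?B * t")
proof -
  have bound: "norm (slope u (g u) (h u) - slope u (h u) (h u)) \<le> ?B" if u: "u \<in> {0..t}" for u
  proof -
    have "norm (slope u (g u) (h u) - slope u (h u) (h u)) \<le> 2 / (1 - \<rho>) ^ 3 * M * norm (g u - h u)"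
      using trajectory_norm_mono[OF g(1) u] trajectory_norm_mono[OF h(1) u] u g h \<rho>
      by (intro slope_lipschitz) auto
    also have "\<dots> \<le> ?B"
      using M_nonneg \<rho> by (intro mult_left_mono trajectory_diff_le g h u) auto
    finally show ?thesis .
  qed
  have int: "((\<lambda>u. slope u (g u) (h u) - slope u (h u) (h u)) has_integral
      integral {0..t} (\<lambda>u. slope u (g u) (h u)) - integral {0..t} (\<lambda>u. slope u (h u) (h u))) {0..t}"
    using g h by (intro has_integral_diff integrable_integral slope_integrable_on) (auto simp: trajectory_def)
  have "norm (integral {0..t} (\<lambda>u. slope u (g u) (h u)) - integral {0..t} (\<lambda>u. slope u (h u) (h u)))
      \<le> ?B * Henstock_Kurzweil_Integration.content {0..t}"
    by (rule has_integral_bound_real[OF _ finite.emptyI int]) (use bound M_nonneg \<rho> in auto)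
  then show ?thesis using t by simp
qed

text \<open>By \<open>trajectory_diff\<close> the difference quotient of \<open>w \<mapsto> G w 0\<close> at \<open>v\<close> is the exponential of minus the
  integral of \<open>slope u (G w u) (G v u)\<close>. As \<open>w\<close> tends to \<open>v\<close> this integral converges, because \<open>G w\<close>
  tends to \<open>G v\<close> uniformly on \<open>{0..t}\<close> and \<open>slope\<close> is Lipschitz on compact disks.\<close>

lemma holomorphic_initial_value:
  assumes t: "0 \<le> t" and G: "\<And>w. w \<in> ball 0 1 \<Longrightarrow> trajectory t (G w) \<and> G w t = w"
  shows "(\<lambda>w. G w 0) holomorphic_on ball 0 1"
proof -
  have "\<exists>D. ((\<lambda>w. G w 0) has_field_derivative D) (at v)" if v: "v \<in> ball 0 1" for v
  proof -
    define I where "I w = integral {0..t} (\<lambda>u. slope u (G w u) (G v u))" for w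
    define \<rho> where "\<rho> = (1 + norm v) / 2"
    have \<rho>: "norm v < \<rho>" "\<rho> < 1" using v by (auto simp: \<rho>_def)
    define C where "C = 2 / (1 - \<rho>) ^ 3 * M * exp (2 * ((2 / (1 - \<rho>)\<^sup>2 + 1) * M * t)) * t"
    have near: "\<forall>\<^sub>F w in at v. w \<in> ball 0 \<rho> \<and> w \<noteq> v"
      using \<rho> by (intro eventually_conj eventually_at_in_open' eventually_neq_at_within) auto
    have "(I \<longlongrightarrow> I v) (at v)"
    proof (rule Lim_null_comparison[THEN LIM_zero_cancel])
      show "\<forall>\<^sub>F w in at v. norm (I w - I v) \<le> C * norm (w - v)"
        using near
      proof eventually_elim
        case (elim w)
        then have "w \<in> ball 0 1" using \<rho> by auto
        then show ?case
          using slope_integral_lipschitz[of t "G w" \<rho> "G v"] G[of w] G[of v] v elim \<rho> t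
          by (simp add: I_def C_def mult_ac)
      qed
      have "((\<lambda>w. C * norm (w - v)) \<longlongrightarrow> C * norm (v - v)) (at v)" by (intro tendsto_intros)
      then show "((\<lambda>w. C * norm (w - v)) \<longlongrightarrow> 0) (at v)" by simp
    qed
    then have "((\<lambda>w. exp (- I w)) \<longlongrightarrow> exp (- I v)) (at v)" by (intro tendsto_intros)
    then have "((\<lambda>w. (G w 0 - G v 0) / (w - v)) \<longlongrightarrow> exp (- I v)) (at v)"
    proof (rule Lim_transform_eventually)
      show "\<forall>\<^sub>F w in at v. exp (- I w) = (G w 0 - G v 0) / (w - v)"
        using near
      proof eventually_elim
        case (elim w)
        then have "w \<in> ball 0 1" using \<rho> by auto
        then have "w - v = (G w 0 - G v 0) * exp (I w)"
          using trajectory_diff[of t "G w" "G v" t] G[of w] G[of v] v t by (simp add: I_def)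
        with elim show ?case by (simp add: exp_minus field_simps)
      qed
    qed
    then show ?thesis by (auto simp: has_field_derivative_iff)
  qed
  then show ?thesis
    by (auto simp: holomorphic_on_open)
qed

text \<open>The function \<open>f\<close> sending \<open>w\<close> to the starting point of the solution that is at \<open>w\<close> at time \<open>t\<close> is
  injective and holomorphic, and its image is the set of points of lifetime greater than \<open>t\<close>. That
  image is open, so the points of lifetime at most \<open>t\<close> form a relatively closed subset of the disk
  and passing to the closure adds no point of the disk to the hull.\<close>

theorem loewner_inverse_self_map:
  assumes t: "0 \<le> t"
  shows "loewner_inverse \<mu> t holomorphic_on ball 0 1"
    and "loewner_inverse \<mu> t ` ball 0 1 \<subseteq> ball 0 1"
    and "loewner_inverse \<mu> t 0 = 0"
proof -
  have "\<forall>w\<in>ball 0 1. \<exists>g. \<exists>T. ereal t < T \<and> loewner_solution \<mu> (g 0) T g \<and> g t = w"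
    using loewner_solution_through[OF _ t] by (metis mem_ball_0)
  then obtain G where "\<forall>w\<in>ball 0 1. \<exists>T. ereal t < T \<and> loewner_solution \<mu> (G w 0) T (G w) \<and> G w t = w"
    by (auto dest: bchoice)
  then have G: "\<exists>T. ereal t < T \<and> loewner_solution \<mu> (G w 0) T (G w)" "G w t = w" if "w \<in> ball 0 1" for w
    using that by auto
  have traj: "trajectory t (G w)" if "w \<in> ball 0 1" for w
    using G(1)[OF that] loewner_solution_trajectory by blast
  define f where "f w = G w 0" for w
  have t0: "t \<in> {0..t}" "0 \<in> {0..t}" using t by auto
  have holo: "f holomorphic_on ball 0 1"
    unfolding f_def using G(2) traj by (intro holomorphic_initial_value[OF t]) auto
  have inj: "inj_on f (ball 0 1)"
  proof (rule inj_onI)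
    fix v w assume "v \<in> ball 0 1" "w \<in> ball 0 1" "f v = f w"
    then show "v = w"
      using trajectory_eqI[OF traj traj t0(2) _ t0(1)] G(2) by (metis f_def)
  qed
  have ball: "f ` ball 0 1 \<subseteq> ball 0 1"
    using trajectory_norm_less[OF traj t0(2)] by (auto simp: f_def)
  have image: "f ` ball 0 1 = {z \<in> ball 0 1. ereal t < loewner_lifetime \<mu> z}" (is "_ = ?R")
  proof (intro equalityI subsetI)
    fix z assume "z \<in> f ` ball 0 1"
    then obtain w where w: "w \<in> ball 0 1" "z = G w 0" by (auto simp: f_def)
    obtain T where T: "ereal t < T" "loewner_solution \<mu> (G w 0) T (G w)" using G(1)[OF w(1)] by blast
    have "0 < T" using T(1) t by (metis ereal_less_eq(5) order_le_less_trans)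
    then have "T \<le> loewner_lifetime \<mu> z"
      unfolding loewner_lifetime_def using T w by (intro Sup_upper) auto
    then show "z \<in> ?R" using T(1) \<open>z \<in> f ` ball 0 1\<close> ball by auto
  next
    fix z assume z: "z \<in> ?R"
    then obtain T g where g: "ereal t < T" "loewner_solution \<mu> z T g"
      by (auto simp: loewner_lifetime_def less_Sup_iff)
    have tr: "trajectory t g" by (rule loewner_solution_trajectory[OF g(2,1)])
    have w: "g t \<in> ball 0 1" using trajectory_norm_less[OF tr t0(1)] by simp
    have "G (g t) 0 = g 0"
      using G(2)[OF w] by (intro trajectory_eqI[OF traj[OF w] tr t0(1) _ t0(2)]) auto
    also have "g 0 = z" using g(2) by (simp add: loewner_solution_def)
    finally show "z \<in> f ` ball 0 1" using w by (auto simp: f_def)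
  qed
  have map: "loewner_map \<mu> t (f w) = w" if w: "w \<in> ball 0 1" for w
    unfolding loewner_map_def
  proof (rule the_equality)
    show "\<exists>T g. ereal t < T \<and> loewner_solution \<mu> (f w) T g \<and> w = g t"
      using G(1)[OF w] G(2)[OF w] by (auto simp: f_def intro!: exI[of _ "G w"])
    fix v assume "\<exists>T g. ereal t < T \<and> loewner_solution \<mu> (f w) T g \<and> v = g t"
    then obtain T g where g: "ereal t < T" "loewner_solution \<mu> (f w) T g" "v = g t" by blast
    have "g 0 = G w 0" using g(2) by (simp add: loewner_solution_def f_def)
    then have "g t = G w t"
      by (intro trajectory_eqI[OF loewner_solution_trajectory[OF g(2,1)] traj[OF w] t0(2) _ t0(1)])
    then show "v = w" using g(3) G(2)[OF w] by simp
  qed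
  have "open (f ` ball 0 1)"
    by (rule open_mapping_thm3[OF holo open_ball inj])
  then have "f ` ball 0 1 \<inter> closure (ball 0 1 - f ` ball 0 1) = {}"
    by (subst open_Int_closure_eq_empty) auto
  moreover have "{z \<in> ball 0 1. loewner_lifetime \<mu> z \<le> ereal t} = ball 0 1 - f ` ball 0 1"
    using image by (auto simp: not_less)
  ultimately have compl: "ball 0 1 - loewner_hull \<mu> t = f ` ball 0 1"
    unfolding loewner_hull_def using ball closure_subset[of "ball 0 1 - f ` ball 0 1"] by auto
  have "inj_on (loewner_map \<mu> t) (f ` ball 0 1)"
    using map by (auto intro!: inj_onI)
  then have inv: "loewner_inverse \<mu> t w = f w" if "w \<in> ball 0 1" for w
    unfolding loewner_inverse_def compl using map that by (intro the_inv_into_f_eq) auto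
  show "loewner_inverse \<mu> t holomorphic_on ball 0 1"
    using holo inv by (subst holomorphic_cong[OF refl, of _ _ f]) auto
  show "loewner_inverse \<mu> t ` ball 0 1 \<subseteq> ball 0 1"
    using ball inv by auto
  have "G 0 0 = 0"
    using trajectory_eqI[OF traj[of 0] trajectory_zero t0(1) _ t0(2)] G(2)[of 0] by simp
  then show "loewner_inverse \<mu> t 0 = 0"
    using inv[of 0] by (simp add: f_def)
qed

end

section \<open>The Herglotz representation\<close>

lemma has_integral_cnjI:
  "(f has_integral I) A \<Longrightarrow> ((\<lambda>x. cnj (f x)) has_integral cnj I) A"
  using has_integral_cnj[of f I A] by (simp add: o_def)

text \<open>Both formulas are contour integrals over the circle of radius \<open>r\<close>: the first is Cauchy's formula
  for the \<open>n\<close>-th derivative at the origin, the second is Cauchy's theorem for \<open>f u * u ^ n\<close>.\<close>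

lemma fourier_coefficients_holomorphic:
  assumes holo: "f holomorphic_on ball 0 1" and r: "0 < r" "r < 1"
  shows fourier_nonneg: "((\<lambda>x. f (of_real r * cis (2 * pi * x)) * cis (- 2 * pi * real n * x))
      has_integral of_real r ^ n * ((deriv ^^ n) f 0 / fact n)) {0..1}"
    and fourier_neg: "((\<lambda>x. f (of_real r * cis (2 * pi * x)) * cis (2 * pi * real (Suc n) * x)) has_integral 0) {0..1}"
proof -
  have circ: "circlepath 0 r x = of_real r * cis (2 * pi * x)" for x
    by (simp add: circlepath cis_conv_exp mult_ac)
  have vec: "vector_derivative (circlepath 0 r) (at x) = 2 * pi * \<i> * of_real r * cis (2 * pi * x)" for x
    by (simp add: vector_derivative_circlepath cis_conv_exp mult_ac)
  have pow: "cis (2 * pi * x) ^ k = cis (2 * pi * real k * x)" for x k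
    by (simp add: Complex.DeMoivre mult_ac)
  have nz: "complex_of_real r \<noteq> 0" "complex_of_real (2 * pi) * \<i> \<noteq> 0" using r by auto
  have cancel: "a / K * (K / b * d) = a * (d / b)" if "K \<noteq> 0" for a b d K :: complex
    using that by (cases "b = 0") (simp_all add: field_simps)
  have "((\<lambda>u. f u / (u - 0) ^ Suc n) has_contour_integral (2 * pi * \<i> / fact n * (deriv ^^ n) f 0))
      (circlepath 0 r)"
    using r by (intro Cauchy_has_contour_integral_higher_derivative_circlepath
        holomorphic_on_imp_continuous_on holomorphic_on_subset[OF holo]) auto
  then have "((\<lambda>x. of_real r ^ n / (2 * pi * \<i>) * (f (circlepath 0 r x) / (circlepath 0 r x - 0) ^ Suc n *
      vector_derivative (circlepath 0 r) (at x))) has_integral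
      of_real r ^ n / (2 * pi * \<i>) * (2 * pi * \<i> / fact n * (deriv ^^ n) f 0)) {0..1}"
    unfolding has_contour_integral by (rule has_integral_mult_right)
  moreover have "of_real r ^ n / (2 * pi * \<i>) * (f (circlepath 0 r x) / (circlepath 0 r x - 0) ^ Suc n *
      vector_derivative (circlepath 0 r) (at x))
      = f (of_real r * cis (2 * pi * x)) * cis (- 2 * pi * real n * x)" for x
  proof -
    have "cis (2 * pi * x) ^ n * cis (- 2 * pi * real n * x) = 1"
      unfolding pow by (simp add: cis_mult)
    then have "cis (- 2 * pi * real n * x) = 1 / cis (2 * pi * x) ^ n"
      by (simp add: field_simps)
    then show ?thesis
      unfolding vec circ using nz by (simp add: power_mult_distrib field_simps)
  qed
  moreover have "of_real r ^ n / (2 * pi * \<i>) * (2 * pi * \<i> / fact n * (deriv ^^ n) f 0)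
      = of_real r ^ n * ((deriv ^^ n) f 0 / fact n)"
    using cancel[OF nz(2), of "of_real r ^ n" "fact n" "(deriv ^^ n) f 0"] .
  ultimately show "((\<lambda>x. f (of_real r * cis (2 * pi * x)) * cis (- 2 * pi * real n * x))
      has_integral of_real r ^ n * ((deriv ^^ n) f 0 / fact n)) {0..1}"
    by (simp only:)
  have "((\<lambda>u. f u * u ^ n) has_contour_integral 0) (circlepath 0 r)"
    using r by (intro Cauchy_theorem_disc_simple[of _ 0 1] holomorphic_intros holo) auto
  then have "((\<lambda>x. 1 / (2 * pi * \<i> * of_real r ^ Suc n) * (f (circlepath 0 r x) * circlepath 0 r x ^ n *
      vector_derivative (circlepath 0 r) (at x))) has_integral
      1 / (2 * pi * \<i> * of_real r ^ Suc n) * 0) {0..1}"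
    unfolding has_contour_integral by (rule has_integral_mult_right)
  moreover have "1 / (2 * pi * \<i> * of_real r ^ Suc n) * (f (circlepath 0 r x) * circlepath 0 r x ^ n *
      vector_derivative (circlepath 0 r) (at x))
      = f (of_real r * cis (2 * pi * x)) * cis (2 * pi * real (Suc n) * x)" for x
    unfolding pow[symmetric] vec circ using nz by (simp add: power_mult_distrib field_simps)
  ultimately show "((\<lambda>x. f (of_real r * cis (2 * pi * x)) * cis (2 * pi * real (Suc n) * x)) has_integral 0) {0..1}"
    by simp
qed

text \<open>Since \<open>2 Re f = f + cnj f\<close>, a Fourier coefficient of the density is that of \<open>1\<close> plus that of \<open>f\<close>
  plus the conjugate of the opposite one of \<open>f\<close>, and the last vanishes for \<open>n > 0\<close>.
  For \<open>n = 0\<close> both contributions of \<open>f\<close> vanish because \<open>f 0 = 0\<close>.\<close>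

lemma fourier_boundary_density:
  assumes holo: "f holomorphic_on ball 0 1" and f0: "f 0 = 0" and r: "0 < r" "r < 1"
  shows "((\<lambda>x. (1 + 2 * Re (f (of_real r * cis (2 * pi * x)))) *\<^sub>R cis (- 2 * pi * real n * x))
      has_integral (if n = 0 then 1 else of_real r ^ n * ((deriv ^^ n) f 0 / fact n))) {0..1}"
proof -
  let ?F = "\<lambda>x. f (of_real r * cis (2 * pi * x))"
  have split: "(1 + 2 * Re (?F x)) *\<^sub>R c = c + ?F x * c + cnj (?F x * cnj c)" for x c
  proof -
    have "complex_of_real (2 * Re (?F x)) = ?F x + cnj (?F x)" by (simp add: complex_add_cnj)
    then show ?thesis by (simp add: scaleR_conv_of_real algebra_simps)
  qed
  have pos: "((\<lambda>x. ?F x * cis (- 2 * pi * real n * x)) has_integral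
      of_real r ^ n * ((deriv ^^ n) f 0 / fact n)) {0..1}"
    by (rule fourier_nonneg[OF holo r])
  show ?thesis
  proof (cases n)
    case 0
    have F: "(?F has_integral 0) {0..1}" using pos f0 unfolding 0 by simp
    have one: "((\<lambda>x. 1 :: complex) has_integral 1) {0..1 :: real}"
      using has_integral_const_real[of "1 :: complex" 0 1] by simp
    from has_integral_add[OF has_integral_add[OF one F] has_integral_cnjI[OF F]]
    show ?thesis unfolding split by (simp add: 0)
  next
    case (Suc m)
    have one: "((\<lambda>x. cis (- 2 * pi * real n * x)) has_integral 0) {0..1}"
    proof -
      have "((\<lambda>x. cnj (1 * cis (2 * pi * real (Suc m) * x))) has_integral cnj 0) {0..1}"
        using has_integral_cnjI[OF fourier_neg[OF holomorphic_on_const r, of 1 m]] .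
      then show ?thesis by (simp add: Suc cis_cnj)
    qed
    have neg: "((\<lambda>x. cnj (?F x * cis (2 * pi * real (Suc m) * x))) has_integral cnj 0) {0..1}"
      using has_integral_cnjI[OF fourier_neg[OF holo r, of m]] .
    from has_integral_add[OF has_integral_add[OF one pos] neg]
    show ?thesis unfolding split by (simp add: Suc cis_cnj)
  qed
qed

text \<open>The angle is kept as a real variable \<open>x\<close> in \<open>{0..1}\<close> so that the selection theorem for
  distributions on the real line applies. The interval \<open>{-1<..2}\<close> witnesses tightness uniformly
  in \<open>r\<close>.\<close>

lemma boundary_distribution:
  assumes holo: "f holomorphic_on ball 0 1" and f0: "f 0 = 0"
    and Re: "\<And>z. z \<in> ball 0 1 \<Longrightarrow> - 1 / 2 \<le> Re (f z)" and r: "0 < r" "r < 1"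
  obtains m where "real_distribution m" "measure m {-1<..2} = 1"
    "\<And>n. (\<integral>x. cis (- 2 * pi * real n * x) \<partial>m)
      = (if n = 0 then 1 else of_real r ^ n * ((deriv ^^ n) f 0 / fact n))"
proof -
  define \<rho> where "\<rho> x = 1 + 2 * Re (f (of_real r * cis (2 * pi * x)))" for x
  define m where "m = density lborel (\<lambda>x. ennreal (indicator {0..1} x * \<rho> x))"
  have nonneg: "0 \<le> \<rho> x" for x
    using Re[of "of_real r * cis (2 * pi * x)"] r by (simp add: \<rho>_def norm_mult)
  have cont: "continuous_on UNIV \<rho>"
    unfolding \<rho>_def
    by (intro continuous_intros continuous_on_compose2[OF holomorphic_on_imp_continuous_on[OF holo]])
       (use r in \<open>auto simp: norm_mult intro!: continuous_intros\<close>)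
  then have [measurable]: "\<rho> \<in> borel_measurable borel" by (rule borel_measurable_continuous_onI)
  have fourier: "((\<lambda>x. \<rho> x *\<^sub>R cis (- 2 * pi * real n * x))
      has_integral (if n = 0 then 1 else of_real r ^ n * ((deriv ^^ n) f 0 / fact n))) {0..1}" for n
    unfolding \<rho>_def by (rule fourier_boundary_density[OF holo f0 r])
  have "(\<rho> has_integral 1) {0..1}"
    using has_integral_Re[OF fourier[of 0]] by simp
  then have total: "(\<integral>\<^sup>+ x. ennreal (indicator {0..1} x * \<rho> x) \<partial>lborel) = 1"
    using nn_integral_has_integral_lebesgue[of "{0..1}" \<rho> 1] nonneg by simp
  have em: "emeasure m A = 1" if "A \<in> sets borel" "{0..1} \<subseteq> A" for A
  proof -
    have "emeasure m A = (\<integral>\<^sup>+ x. ennreal (indicator {0..1} x * \<rho> x) * indicator A x \<partial>lborel)"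
      unfolding m_def using that by (intro emeasure_density) auto
    also have "\<dots> = (\<integral>\<^sup>+ x. ennreal (indicator {0..1} x * \<rho> x) \<partial>lborel)"
      using that by (intro nn_integral_cong) (auto simp: indicator_def)
    finally show ?thesis using total by simp
  qed
  show thesis
  proof
    show "real_distribution m"
      unfolding real_distribution_def real_distribution_axioms_def
      using em[of UNIV] by (auto intro!: prob_spaceI simp: m_def)
    show "measure m {-1<..2} = 1"
      using em[of "{-1<..2}"] by (simp add: measure_def subset_iff)
    fix n :: nat
    have "(\<integral>x. cis (- 2 * pi * real n * x) \<partial>m)
        = (\<integral>x. (indicator {0..1} x * \<rho> x) *\<^sub>R cis (- 2 * pi * real n * x) \<partial>lborel)"
      unfolding m_def using nonneg
      by (intro integral_density) (auto intro!: borel_measurable_continuous_onI continuous_intros AE_I2)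
    also have "\<dots> = set_lebesgue_integral lborel {0..1} (\<lambda>x. \<rho> x *\<^sub>R cis (- 2 * pi * real n * x))"
      by (simp add: set_lebesgue_integral_def)
    also have "\<dots> = integral {0..1} (\<lambda>x. \<rho> x *\<^sub>R cis (- 2 * pi * real n * x))"
      by (intro set_borel_integral_eq_integral borel_integrable_atLeastAtMost' continuous_intros
          continuous_on_subset[OF cont]) auto
    also have "\<dots> = (if n = 0 then 1 else of_real r ^ n * ((deriv ^^ n) f 0 / fact n))"
      by (rule integral_unique[OF fourier])
    finally show "(\<integral>x. cis (- 2 * pi * real n * x) \<partial>m)
      = (if n = 0 then 1 else of_real r ^ n * ((deriv ^^ n) f 0 / fact n))" .
  qed
qed

text \<open>A weak limit of the boundary distributions along radii tending to \<open>1\<close>, wrapped around the circle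
  by \<open>x \<mapsto> cis (2 * pi * x)\<close>. The moments are integrals of bounded continuous functions, so
  they pass to the limit.\<close>

lemma boundary_moments:
  assumes holo: "f holomorphic_on ball 0 1" and f0: "f 0 = 0"
    and Re: "\<And>z. z \<in> ball 0 1 \<Longrightarrow> - 1 / 2 \<le> Re (f z)"
  obtains \<nu> where "\<nu> \<in> circle_measures" "prob_space \<nu>"
    "\<And>n. n > 0 \<Longrightarrow> (\<integral>w. cnj w ^ n \<partial>\<nu>) = (deriv ^^ n) f 0 / fact n"
proof -
  define r where "r k = 1 - 1 / (real k + 2)" for k
  have r: "0 < r k" "r k < 1" for k by (auto simp: r_def field_simps)
  have r_lim: "r \<longlonglongrightarrow> 1" unfolding r_def by real_asymp
  have "\<exists>m. real_distribution m \<and> measure m {-1<..2} = 1 \<and>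
      (\<forall>n. (\<integral>x. cis (- 2 * pi * real n * x) \<partial>m)
        = (if n = 0 then 1 else of_real (r k) ^ n * ((deriv ^^ n) f 0 / fact n)))" for k
    using boundary_distribution[OF holo f0 Re r] by metis
  then obtain m where m: "\<And>k. real_distribution (m k)" "\<And>k. measure (m k) {-1<..2} = 1"
    "\<And>k n. (\<integral>x. cis (- 2 * pi * real n * x) \<partial>m k)
        = (if n = 0 then 1 else of_real (r k) ^ n * ((deriv ^^ n) f 0 / fact n))"
    by metis
  have "tight m"
    unfolding tight_def
  proof (intro conjI allI impI)
    fix \<epsilon> :: real assume "\<epsilon> > 0"
    then have "-1 < (2 :: real) \<and> (\<forall>n. 1 - \<epsilon> < measure (m n) {-1<..2})" by (simp add: m(2))
    then show "\<exists>a b. a < b \<and> (\<forall>n. 1 - \<epsilon> < measure (m n) {a<..b})" by blast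
  qed (rule m(1))
  from tight_imp_convergent_subsubsequence[OF this strict_mono_id]
  obtain s m' where s: "strict_mono s" and m': "real_distribution m'" "weak_conv_m (\<lambda>k. m (s k)) m'"
    by (auto simp: o_def)
  interpret m': real_distribution m' by fact
  have lim_moment: "(\<integral>x. cis (- 2 * pi * real n * x) \<partial>m') = (deriv ^^ n) f 0 / fact n" if "n > 0" for n
  proof (rule LIMSEQ_unique)
    have "continuous_on UNIV (\<lambda>x. cis (- 2 * pi * real n * x))" by (intro continuous_intros)
    then show "(\<lambda>k. \<integral>x. cis (- 2 * pi * real n * x) \<partial>m (s k)) \<longlonglongrightarrow> (\<integral>x. cis (- 2 * pi * real n * x) \<partial>m')"
      by (intro weak_conv_imp_integral_bdd_continuous_conv[OF m(1) m', where B = 1])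
         (auto simp: continuous_on_eq_continuous_at)
    have "(\<lambda>k. r (s k)) \<longlonglongrightarrow> 1"
      using LIMSEQ_subseq_LIMSEQ[OF r_lim s] by (simp add: o_def)
    then have "(\<lambda>k. of_real (r (s k)) ^ n * ((deriv ^^ n) f 0 / fact n)) \<longlonglongrightarrow>
        of_real 1 ^ n * ((deriv ^^ n) f 0 / fact n)"
      by (intro tendsto_intros)
    then show "(\<lambda>k. \<integral>x. cis (- 2 * pi * real n * x) \<partial>m (s k)) \<longlonglongrightarrow> (deriv ^^ n) f 0 / fact n"
      using that unfolding m(3) by simp
  qed
  define e where "e x = cis (2 * pi * x)" for x
  define \<nu> where "\<nu> = distr m' (restrict_space borel (sphere 0 1)) e"
  have "e \<in> borel_measurable borel"
    unfolding e_def by (intro borel_measurable_continuous_onI continuous_intros)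
  then have e[measurable]: "e \<in> m' \<rightarrow>\<^sub>M restrict_space borel (sphere 0 1)"
    by (intro measurable_restrict_space2) (auto simp: e_def)
  show thesis
  proof
    show circ: "\<nu> \<in> circle_measures" by (simp add: \<nu>_def circle_measures_def)
    show "prob_space \<nu>" unfolding \<nu>_def by (rule m'.prob_space_distr[OF e])
    fix n :: nat assume "n > 0"
    have "(\<integral>w. cnj w ^ n \<partial>\<nu>) = (\<integral>x. cnj (e x) ^ n \<partial>m')"
      unfolding \<nu>_def
      by (intro integral_distr e borel_measurable_continuous_on_restrict continuous_intros)
    also have "\<dots> = (\<integral>x. cis (- 2 * pi * real n * x) \<partial>m')"
      by (simp add: e_def cis_cnj Complex.DeMoivre mult_ac)
    finally show "(\<integral>w. cnj w ^ n \<partial>\<nu>) = (deriv ^^ n) f 0 / fact n"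
      using lim_moment[OF \<open>n > 0\<close>] by simp
  qed
qed

text \<open>The kernel is the geometric series of \<open>z * cnj w\<close> without its constant term, so the moments are
  the Taylor coefficients of the integral.\<close>

lemma moment_series:
  assumes \<nu>: "\<nu> \<in> circle_measures" "prob_space \<nu>" and z: "z \<in> ball 0 1"
  shows "(\<lambda>n. (\<integral>w. cnj w ^ Suc n \<partial>\<nu>) * z ^ Suc n) sums (\<integral>w. z * cnj w / (1 - z * cnj w) \<partial>\<nu>)"
proof -
  interpret prob_space \<nu> by fact
  have int: "integrable \<nu> g" if "continuous_on (sphere 0 1) g" for g :: "complex \<Rightarrow> complex"
    using circle_measures_integrable[OF \<nu>(1) _ that] finite_measure_axioms by blast
  have sp: "norm w = 1" if "w \<in> space \<nu>" for w
    using circle_measures_space[OF \<nu>(1)] that by auto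
  have nrm: "norm ((z * cnj w) ^ Suc n) = norm z ^ Suc n" if "w \<in> space \<nu>" for w n
    using sp[OF that] by (simp add: norm_mult norm_power)
  have summ: "summable (\<lambda>n. norm z ^ Suc n)"
    using z by (subst summable_Suc_iff) (auto intro: summable_geometric)
  have "(\<lambda>n. \<integral>w. (z * cnj w) ^ Suc n \<partial>\<nu>) sums (\<integral>w. (\<Sum>n. (z * cnj w) ^ Suc n) \<partial>\<nu>)"
  proof (rule sums_integral)
    show "integrable \<nu> (\<lambda>w. (z * cnj w) ^ Suc n)" for n
      by (intro int continuous_intros)
    show "AE w in \<nu>. summable (\<lambda>n. norm ((z * cnj w) ^ Suc n))"
      using summ nrm by (intro AE_I2) simp
    have "(\<integral>w. norm ((z * cnj w) ^ Suc n) \<partial>\<nu>) = norm z ^ Suc n" for n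
    proof -
      have "(\<integral>w. norm ((z * cnj w) ^ Suc n) \<partial>\<nu>) = (\<integral>w. norm z ^ Suc n \<partial>\<nu>)"
        by (rule Bochner_Integration.integral_cong[OF refl nrm])
      then show ?thesis by (simp add: prob_space)
    qed
    then show "summable (\<lambda>n. \<integral>w. norm ((z * cnj w) ^ Suc n) \<partial>\<nu>)" using summ by simp
  qed
  moreover have "(\<integral>w. (\<Sum>n. (z * cnj w) ^ Suc n) \<partial>\<nu>) = (\<integral>w. z * cnj w / (1 - z * cnj w) \<partial>\<nu>)"
  proof (rule Bochner_Integration.integral_cong[OF refl])
    fix w assume "w \<in> space \<nu>"
    then have "norm (z * cnj w) < 1" using sp z by (simp add: norm_mult)
    then have "(\<lambda>n. (z * cnj w) * (z * cnj w) ^ n) sums ((z * cnj w) * (1 / (1 - z * cnj w)))"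
      by (intro sums_mult geometric_sums)
    then show "(\<Sum>n. (z * cnj w) ^ Suc n) = z * cnj w / (1 - z * cnj w)"
      by (simp add: sums_iff)
  qed
  moreover have "(\<integral>w. (z * cnj w) ^ Suc n \<partial>\<nu>) = (\<integral>w. cnj w ^ Suc n \<partial>\<nu>) * z ^ Suc n" for n
    by (simp add: power_mult_distrib mult_ac flip: integral_mult_left_zero integral_mult_right_zero)
  ultimately show ?thesis by simp
qed

theorem herglotz_representation:
  assumes holo: "f holomorphic_on ball 0 1" and f0: "f 0 = 0"
    and Re: "\<And>z. z \<in> ball 0 1 \<Longrightarrow> - 1 / 2 \<le> Re (f z)"
  shows "\<exists>\<nu>. \<nu> \<in> circle_measures \<and> prob_space \<nu> \<and>
    (\<forall>z\<in>ball 0 1. f z = (\<integral>w. z * cnj w / (1 - z * cnj w) \<partial>\<nu>))"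
proof -
  obtain \<nu> where \<nu>: "\<nu> \<in> circle_measures" "prob_space \<nu>"
    and mom: "\<And>n. n > 0 \<Longrightarrow> (\<integral>w. cnj w ^ n \<partial>\<nu>) = (deriv ^^ n) f 0 / fact n"
    using boundary_moments[OF holo f0 Re] by blast
  have "f z = (\<integral>w. z * cnj w / (1 - z * cnj w) \<partial>\<nu>)" if z: "z \<in> ball 0 1" for z
  proof (rule sums_unique2[OF _ moment_series[OF \<nu> z]])
    have "(\<lambda>n. (deriv ^^ n) f 0 / fact n * (z - 0) ^ n) sums f z"
      by (rule holomorphic_power_series[OF holo z])
    then have "(\<lambda>n. (deriv ^^ Suc n) f 0 / fact (Suc n) * (z - 0) ^ Suc n) sums f z"
      by (subst sums_Suc_iff) (simp add: f0)
    then show "(\<lambda>n. (\<integral>w. cnj w ^ Suc n \<partial>\<nu>) * z ^ Suc n) sums f z"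
      by (simp add: mom del: power_Suc funpow.simps fact_Suc)
  qed
  with \<nu> show ?thesis by blast
qed

section \<open>Measures on the circle are determined by their moments\<close>

text \<open>The indicator of a closed set is the pointwise limit of the continuous functions
  \<open>max 0 (1 - n * infdist x C)\<close>, and the closed sets generate the Borel sets.\<close>

lemma measure_eqI_continuous:
  fixes M N :: "'a::metric_space measure"
  assumes M: "finite_measure M" "sets M = sets borel" and N: "finite_measure N" "sets N = sets borel"
    and eq: "\<And>h :: 'a \<Rightarrow> real. continuous_on UNIV h \<Longrightarrow> (\<integral>x. h x \<partial>M) = (\<integral>x. h x \<partial>N)"
  shows "M = N"
proof -
  have lim: "(\<lambda>n. \<integral>x. max 0 (1 - real n * infdist x C) \<partial>P) \<longlonglongrightarrow> measure P C"
    if P: "finite_measure P" "sets P = sets borel" and C: "closed C" "C \<noteq> {}" for C :: "'a set" and P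
  proof -
    interpret P: finite_measure P by fact
    have meas: "g \<in> borel_measurable P" if "continuous_on UNIV g" for g :: "'a \<Rightarrow> real"
      using borel_measurable_continuous_onI[OF that] measurable_cong_sets[OF P(2) refl] by blast
    have Cs: "C \<in> sets P" using C P by simp
    have "(\<lambda>n. \<integral>x. max 0 (1 - real n * infdist x C) \<partial>P) \<longlonglongrightarrow> (\<integral>x. indicator C x \<partial>P)"
    proof (rule integral_dominated_convergence[where w = "\<lambda>_. 1"])
      show "AE x in P. (\<lambda>n. max 0 (1 - real n * infdist x C)) \<longlonglongrightarrow> indicator C x"
      proof (rule AE_I2)
        fix x
        show "(\<lambda>n. max 0 (1 - real n * infdist x C)) \<longlonglongrightarrow> indicator C x"
        proof (cases "x \<in> C")
          case False
          then have pos: "0 < infdist x C"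
            using in_closed_iff_infdist_zero[OF C] infdist_nonneg[of x C] by auto
          obtain k where k: "1 < real k * infdist x C"
            using reals_Archimedean3[OF pos] by blast
          have "1 - real n * infdist x C \<le> 0" if "n \<ge> k" for n
            using k mult_right_mono[of "real k" "real n" "infdist x C"] that pos by linarith
          then have "\<forall>\<^sub>F n in sequentially. max 0 (1 - real n * infdist x C) = 0"
            by (intro eventually_sequentiallyI[of k] max_absorb1)
          then show ?thesis using False by (simp add: tendsto_eventually)
        qed simp
      qed
      show "AE x in P. norm (max 0 (1 - real n * infdist x C)) \<le> 1" for n
        by (intro AE_I2) (simp add: infdist_nonneg)
    qed (use Cs in \<open>auto intro!: meas continuous_intros\<close>)
    then show ?thesis using Cs sets.sets_into_space[OF Cs] by (simp add: Int_absorb2)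
  qed
  show ?thesis
  proof (rule measure_eqI_generator_eq[where \<Omega> = UNIV and E = "Collect closed" and A = "\<lambda>_. UNIV"])
    fix C :: "'a set" assume "C \<in> Collect closed"
    then have C: "closed C" by simp
    show "emeasure M C = emeasure N C"
    proof (cases "C = {}")
      case False
      have "(\<integral>x. max 0 (1 - real n * infdist x C) \<partial>M) = (\<integral>x. max 0 (1 - real n * infdist x C) \<partial>N)" for n
        by (intro eq continuous_intros)
      then have "measure M C = measure N C"
        using lim[OF M C False] lim[OF N C False] LIMSEQ_unique by simp
      then show ?thesis
        using M(1) N(1) by (simp add: finite_measure.emeasure_eq_measure)
    qed simp
  next
    show "sets M = sigma_sets UNIV (Collect closed)" "sets N = sigma_sets UNIV (Collect closed)"
      using M N by (simp_all add: borel_eq_closed)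
    show "emeasure M UNIV \<noteq> \<infinity>"
      using finite_measure.emeasure_finite[OF M(1)] by simp
  qed (auto simp: Int_stable_def)
qed

text \<open>Polynomials in \<open>w\<close> and \<open>cnj w\<close>. On the circle \<open>cnj w\<close> is the inverse of \<open>w\<close>, so their integrals are
  combinations of moments and conjugates of moments; on the other hand they contain all real polynomials in \<open>Re w\<close> and
  \<open>Im w\<close>, which are the ones that the Stone-Weierstrass theorem provides.\<close>

inductive trig_poly :: "(complex \<Rightarrow> complex) \<Rightarrow> bool" where
  monomial: "trig_poly (\<lambda>w. c * w ^ j * cnj w ^ k)"
| add: "trig_poly p \<Longrightarrow> trig_poly q \<Longrightarrow> trig_poly (\<lambda>w. p w + q w)"

lemma trig_poly_monomial_mult:
  assumes "trig_poly p"
  shows "trig_poly (\<lambda>w. c * w ^ j * cnj w ^ k * p w)"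
  using assms
proof induction
  case (monomial d l m)
  have "(\<lambda>w. c * w ^ j * cnj w ^ k * (d * w ^ l * cnj w ^ m)) = (\<lambda>w. (c * d) * w ^ (j + l) * cnj w ^ (k + m))"
    by (simp add: power_add mult_ac)
  then show ?case using trig_poly.monomial by simp
next
  case (add p q)
  then show ?case using trig_poly.add by (simp add: distrib_left)
qed

lemma trig_poly_mult:
  assumes "trig_poly p" "trig_poly q"
  shows "trig_poly (\<lambda>w. p w * q w)"
  using assms(1)
proof induction
  case (monomial c j k)
  then show ?case using trig_poly_monomial_mult[OF assms(2)] by simp
next
  case (add p1 p2)
  then show ?case using trig_poly.add by (simp add: distrib_right)
qed

lemma trig_poly_of_real_polynomial:
  assumes "real_polynomial_function (p :: complex \<Rightarrow> real)"
  shows "trig_poly (\<lambda>w. complex_of_real (p w))"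
  using assms
proof induction
  case (linear p)
  then interpret bounded_linear p .
  define a b where "a = p 1" and "b = p \<i>"
  have p_eq: "p w = Re w * a + Im w * b" for w
  proof -
    have "p w = p (Re w *\<^sub>R 1 + Im w *\<^sub>R \<i>)" by (simp add: scaleR_conv_of_real mult.commute flip: complex_eq)
    then show ?thesis by (simp only: add scaleR real_scaleR_def a_def b_def)
  qed
  have eq: "complex_of_real (p w) = ((of_real a - \<i> * of_real b) / 2) * w ^ 1 * cnj w ^ 0
      + ((of_real a + \<i> * of_real b) / 2) * w ^ 0 * cnj w ^ 1" for w
    unfolding p_eq by (simp add: complex_eq_iff field_simps)
  show ?case unfolding eq by (intro trig_poly.add trig_poly.monomial)
next
  case (const c)
  then show ?case using trig_poly.monomial[of "of_real c" 0 0] by simp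
next
  case (add f g)
  then show ?case using trig_poly.add by simp
next
  case (mult f g)
  then show ?case using trig_poly_mult by simp
qed

lemma continuous_on_trig_poly: "trig_poly p \<Longrightarrow> continuous_on S p"
  by (induction rule: trig_poly.induct) (auto intro!: continuous_intros)

text \<open>The moments of negative index are the conjugates of those of positive index, and the one of index
  \<open>0\<close> is the total mass. Hence both measures integrate trigonometric polynomials alike, then all
  continuous functions on the circle by uniform approximation.\<close>

theorem circle_measure_eqI_moments:
  assumes \<nu>: "\<nu> \<in> circle_measures" "prob_space \<nu>" and \<nu>': "\<nu>' \<in> circle_measures" "prob_space \<nu>'"
    and mom: "\<And>n. n > 0 \<Longrightarrow> (\<integral>w. cnj w ^ n \<partial>\<nu>) = (\<integral>w. cnj w ^ n \<partial>\<nu>')"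
  shows "\<nu> = \<nu>'"
proof -
  interpret \<nu>: prob_space \<nu> by fact
  interpret \<nu>': prob_space \<nu>' by fact
  have fin: "finite_measure \<nu>" "finite_measure \<nu>'" by unfold_locales
  have int: "integrable \<nu> g" "integrable \<nu>' g" if "continuous_on (sphere 0 1) g"
    for g :: "complex \<Rightarrow> 'b::{banach, second_countable_topology}"
    by (rule circle_measures_integrable[OF _ _ that]; use \<nu> \<nu>' fin in simp)+
  have sp: "norm w = 1" if "w \<in> space \<nu> \<or> w \<in> space \<nu>'" for w
    using circle_measures_space[OF \<nu>(1)] circle_measures_space[OF \<nu>'(1)] that by auto
  have neg: "(\<integral>w. cnj w ^ n \<partial>\<nu>) = (\<integral>w. cnj w ^ n \<partial>\<nu>')" for n
    using mom[of n] by (cases "n = 0") (auto simp: \<nu>.prob_space \<nu>'.prob_space)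
  have pos: "(\<integral>w. w ^ n \<partial>\<nu>) = (\<integral>w. w ^ n \<partial>\<nu>')" for n
  proof -
    have "cnj (\<integral>w. cnj w ^ n \<partial>\<nu>) = cnj (\<integral>w. cnj w ^ n \<partial>\<nu>')" using neg by simp
    then show ?thesis by (simp flip: Bochner_Integration.integral_cnj)
  qed
  have reduce: "w ^ j * cnj w ^ k = (if k \<le> j then w ^ (j - k) else cnj w ^ (k - j))"
    if "norm w = 1" for w :: complex and j k
  proof -
    have one: "w * cnj w = 1" using that by (simp add: complex_mult_cnj cmod_power2[symmetric] del: of_real_power)
    show ?thesis
    proof (cases "k \<le> j")
      case True
      then have "w ^ j * cnj w ^ k = w ^ (j - k) * (w * cnj w) ^ k"
        by (simp add: power_mult_distrib mult.assoc flip: power_add mult.assoc)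
      then show ?thesis using True one by simp
    next
      case False
      then have "w ^ j * cnj w ^ k = cnj w ^ (k - j) * (w * cnj w) ^ j"
        by (simp add: power_mult_distrib mult_ac flip: power_add)
      then show ?thesis using False one by simp
    qed
  qed
  have trig: "(\<integral>w. p w \<partial>\<nu>) = (\<integral>w. p w \<partial>\<nu>')" if "trig_poly p" for p
    using that
  proof induction
    case (monomial c j k)
    have "(\<integral>w. c * w ^ j * cnj w ^ k \<partial>P) = c * (if k \<le> j then (\<integral>w. w ^ (j - k) \<partial>P) else (\<integral>w. cnj w ^ (k - j) \<partial>P))"
      if "\<And>w. w \<in> space P \<Longrightarrow> norm w = 1" for P
    proof -
      have "(\<integral>w. c * w ^ j * cnj w ^ k \<partial>P) = (\<integral>w. c * (if k \<le> j then w ^ (j - k) else cnj w ^ (k - j)) \<partial>P)"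
        by (rule Bochner_Integration.integral_cong[OF refl]) (simp only: mult.assoc reduce[OF that])
      then show ?thesis by simp
    qed
    then show ?case using sp neg pos by auto
  next
    case (add p q)
    then show ?case
      by (simp add: Bochner_Integration.integral_add int continuous_on_trig_poly)
  qed
  have poly: "(\<integral>w. p w \<partial>\<nu>) = (\<integral>w. p w \<partial>\<nu>')" if "real_polynomial_function p" for p :: "complex \<Rightarrow> real"
  proof -
    have "(\<integral>w. complex_of_real (p w) \<partial>\<nu>) = (\<integral>w. complex_of_real (p w) \<partial>\<nu>')"
      by (rule trig[OF trig_poly_of_real_polynomial[OF that]])
    then show ?thesis by simp
  qed
  have cont: "(\<integral>w. h w \<partial>\<nu>) = (\<integral>w. h w \<partial>\<nu>')" if h: "continuous_on (sphere 0 1) h" for h :: "complex \<Rightarrow> real"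
  proof -
    have "\<bar>(\<integral>w. h w \<partial>\<nu>) - (\<integral>w. h w \<partial>\<nu>')\<bar> \<le> 0 + e" if "e > 0" for e :: real
    proof -
      obtain p where p: "real_polynomial_function p" "\<And>w. w \<in> sphere 0 1 \<Longrightarrow> \<bar>h w - p w\<bar> < e / 2"
        using Stone_Weierstrass_real_polynomial_function[OF compact_sphere h, of "e / 2"] \<open>e > 0\<close> by auto
      have pc: "continuous_on (sphere 0 1) p"
        using p(1) continuous_on_polymonial_function real_polynomial_function_eq by blast
      have near: "\<bar>(\<integral>w. h w \<partial>P) - (\<integral>w. p w \<partial>P)\<bar> \<le> e / 2"
        if P: "P \<in> circle_measures" "prob_space P" for P
      proof -
        interpret P: prob_space P by fact
        have i: "integrable P h" "integrable P p"
          using circle_measures_integrable[OF P(1) P.finite_measure_axioms] h pc by auto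
        have "\<bar>(\<integral>w. h w \<partial>P) - (\<integral>w. p w \<partial>P)\<bar> = \<bar>\<integral>w. h w - p w \<partial>P\<bar>" using i by simp
        also have "\<dots> \<le> (\<integral>w. \<bar>h w - p w\<bar> \<partial>P)" by (rule integral_abs_bound)
        also have "\<dots> \<le> (\<integral>w. e / 2 \<partial>P)"
          using i p(2) circle_measures_space[OF P(1)] by (intro integral_mono) (auto intro: less_imp_le)
        finally show ?thesis by (simp add: P.prob_space)
      qed
      show ?thesis using near[OF \<nu>] near[OF \<nu>'] poly[OF p(1)] by linarith
    qed
    then show ?thesis using field_le_epsilon[of "\<bar>(\<integral>w. h w \<partial>\<nu>) - (\<integral>w. h w \<partial>\<nu>')\<bar>" 0] by simp
  qed
  have id: "(\<lambda>w. w) \<in> \<nu> \<rightarrow>\<^sub>M borel" "(\<lambda>w. w) \<in> \<nu>' \<rightarrow>\<^sub>M borel"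
    using \<nu> \<nu>' by (auto intro!: circle_measures_borel_measurable continuous_intros)
  have "distr \<nu> borel (\<lambda>w. w) = distr \<nu>' borel (\<lambda>w. w)"
  proof (rule measure_eqI_continuous)
    fix h :: "complex \<Rightarrow> real" assume h: "continuous_on UNIV h"
    have hb: "h \<in> borel_measurable borel" by (rule borel_measurable_continuous_onI[OF h])
    have "(\<integral>w. h w \<partial>\<nu>) = (\<integral>w. h w \<partial>\<nu>')" by (intro cont continuous_on_subset[OF h]) simp
    then show "(\<integral>w. h w \<partial>distr \<nu> borel (\<lambda>w. w)) = (\<integral>w. h w \<partial>distr \<nu>' borel (\<lambda>w. w))"
      by (simp add: integral_distr[OF id(1) hb] integral_distr[OF id(2) hb])
  qed (auto intro!: \<nu>.finite_measure_distr \<nu>'.finite_measure_distr id)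
  then have em: "emeasure \<nu> (A \<inter> sphere 0 1) = emeasure \<nu>' (A \<inter> sphere 0 1)" if "A \<in> sets borel" for A
    using emeasure_distr[OF id(1) that] emeasure_distr[OF id(2) that]
      circle_measures_space[OF \<nu>(1)] circle_measures_space[OF \<nu>'(1)] by simp
  show ?thesis
  proof (rule measure_eqI)
    show "sets \<nu> = sets \<nu>'" using \<nu>(1) \<nu>'(1) by (simp add: circle_measures_def)
    fix A assume "A \<in> sets \<nu>"
    then obtain B where "B \<in> sets borel" "A = B \<inter> sphere 0 1"
      using \<nu>(1) by (auto simp: circle_measures_def sets_restrict_space)
    then show "emeasure \<nu> A = emeasure \<nu>' A" using em by simp
  qed
qed

lemma herglotz_measure_unique:
  assumes \<nu>: "\<nu> \<in> circle_measures" "prob_space \<nu>" and \<nu>': "\<nu>' \<in> circle_measures" "prob_space \<nu>'"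
    and eq: "\<And>z. z \<in> ball 0 1 \<Longrightarrow>
      (\<integral>w. z * cnj w / (1 - z * cnj w) \<partial>\<nu>) = (\<integral>w. z * cnj w / (1 - z * cnj w) \<partial>\<nu>')"
  shows "\<nu> = \<nu>'"
proof -
  define a where "a P n = (if n = 0 then 0 else \<integral>w. cnj w ^ n \<partial>P)" for P and n :: nat
  define I where "I P z = (\<integral>w. z * cnj w / (1 - z * cnj w) \<partial>P)" for P z
  have sums: "(\<lambda>n. a P n * z ^ n) sums I P z"
    if "P \<in> circle_measures" "prob_space P" "z \<in> ball 0 1" for P z
  proof -
    have "(\<lambda>n. a P (Suc n) * z ^ Suc n) sums I P z"
      unfolding I_def a_def using moment_series[OF that] by simp
    then show ?thesis by (subst (asm) sums_Suc_iff) (simp add: a_def)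
  qed
  have radius: "0 < fps_conv_radius (Abs_fps (a P))" if "P \<in> circle_measures" "prob_space P" for P
  proof -
    have "summable (\<lambda>n. a P n * (1 / 2) ^ n)"
      using sums[OF that, of "1 / 2"] by (auto simp: sums_iff)
    then have "norm (1 / 2 :: complex) \<le> conv_radius (a P)" by (rule conv_radius_geI)
    then have "0 < conv_radius (a P)" by (rule less_le_trans[rotated]) simp
    then show ?thesis by (simp add: fps_conv_radius_def)
  qed
  have "Abs_fps (a \<nu>) = Abs_fps (a \<nu>')"
  proof (rule eval_fps_eqD[OF radius[OF \<nu>] radius[OF \<nu>']])
    have "\<forall>\<^sub>F z in nhds 0. z \<in> ball (0 :: complex) 1"
      by (rule eventually_nhds_in_open) auto
    then show "\<forall>\<^sub>F z in nhds 0. eval_fps (Abs_fps (a \<nu>)) z = eval_fps (Abs_fps (a \<nu>')) z"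
    proof eventually_elim
      case (elim z)
      have "I \<nu> z = I \<nu>' z" unfolding I_def by (rule eq[OF elim])
      then show ?case
        using sums[OF \<nu> elim] sums[OF \<nu>' elim] by (simp add: eval_fps_def sums_iff)
    qed
  qed
  then have "a \<nu> n = a \<nu>' n" for n by (simp add: fps_eq_iff)
  then show ?thesis
    by (intro circle_measure_eqI_moments[OF \<nu> \<nu>']) (metis a_def less_irrefl)
qed

section \<open>Representation of the transformed inverse map\<close>

lemma piecewise_weakly_continuous_finite_jumps:
  assumes "piecewise_weakly_continuous \<mu>"
  shows "finite {s \<in> {0..b}. \<not> weakly_continuous_at \<mu> s}"
  using assms unfolding piecewise_weakly_continuous_def
proof (elim exE conjE)
  fix S assume "\<forall>b. finite (S \<inter> {0..b})" and S: "\<forall>t\<in>{0..} - S. weakly_continuous_at \<mu> t"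
  then have "finite (S \<inter> {0..b})" by blast
  then show ?thesis by (rule finite_subset[rotated]) (use S in auto)
qed

lemma radial_drivingI:
  assumes "\<forall>t\<ge>0. \<mu> t \<in> circle_measures" "piecewise_weakly_continuous \<mu>"
    and M: "\<forall>t\<ge>0. emeasure (\<mu> t) (sphere 0 1) \<le> ennreal M"
  shows "radial_driving \<mu> (max M 0)"
proof
  show "finite {s \<in> {0..b}. \<not> weakly_continuous_at \<mu> s}" for b
    by (rule piecewise_weakly_continuous_finite_jumps[OF assms(2)])
  show "emeasure (\<mu> t) (sphere 0 1) \<le> ennreal (max M 0)" if "t \<ge> 0" for t
    using M that by (auto intro: order_trans[OF _ ennreal_leI[OF max.cobounded1]])
qed (use assms(1) in auto)

theorem lemma3:
  fixes \<mu> :: "real \<Rightarrow> complex measure"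
  assumes "\<forall>t\<ge>0. \<mu> t \<in> circle_measures"
    and "piecewise_weakly_continuous \<mu>"
    and "\<exists>M :: real. \<forall>t\<ge>0. emeasure (\<mu> t) (sphere 0 1) \<le> ennreal M"
  shows "\<forall>t\<ge>0. \<exists>!\<nu>. \<nu> \<in> circle_measures \<and> prob_space \<nu> \<and>
    (\<forall>z\<in>ball 0 1. loewner_psi \<mu> t z = (\<integral>w. z * cnj w / (1 - z * cnj w) \<partial>\<nu>))"
proof (intro allI impI)
  fix t :: real assume t: "t \<ge> 0"
  obtain M where M: "\<forall>t\<ge>0. emeasure (\<mu> t) (sphere 0 1) \<le> ennreal M"
    using assms(3) by blast
  interpret radial_driving \<mu> "max M 0" by (rule radial_drivingI[OF assms(1,2) M])
  let ?f = "loewner_inverse \<mu> t" and ?\<psi> = "loewner_psi \<mu> t"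
  note f = loewner_inverse_self_map[OF t]
  have f_less: "norm (?f z) < 1" if "z \<in> ball 0 1" for z
    using f(2) that by (auto simp: image_subset_iff)
  then have ne: "1 - ?f z \<noteq> 0" if "z \<in> ball 0 1" for z
    using that by (metis norm_one unit_minus_nonzero(1))
  have \<psi>: "?\<psi> = (\<lambda>z. ?f z / (1 - ?f z))"
    by (simp add: loewner_psi_def fun_eq_iff)
  have "?\<psi> holomorphic_on ball 0 1"
    unfolding \<psi> by (intro holomorphic_intros f(1) ne)
  moreover have "?\<psi> 0 = 0" by (simp add: \<psi> f(3))
  moreover have "- 1 / 2 \<le> Re (?\<psi> z)" if z: "z \<in> ball 0 1" for z
  proof -
    \<comment> \<open>The lower bound \<open>- 1 / 2\<close> is nonnegativity of the real part of the Cayley transform of \<open>?f z\<close>.\<close>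
    have "(1 + ?f z) / (1 - ?f z) = 1 + 2 * ?\<psi> z"
      using ne[OF z] by (simp add: \<psi> field_simps)
    moreover have "0 \<le> Re ((1 + ?f z) / (1 - ?f z))"
      using f_less[OF z] by (intro Re_cayley_nonneg) auto
    ultimately show ?thesis by simp
  qed
  ultimately obtain \<nu> where \<nu>: "\<nu> \<in> circle_measures" "prob_space \<nu>"
    and rep: "\<forall>z\<in>ball 0 1. ?\<psi> z = (\<integral>w. z * cnj w / (1 - z * cnj w) \<partial>\<nu>)"
    using herglotz_representation by blast
  show "\<exists>!\<nu>. \<nu> \<in> circle_measures \<and> prob_space \<nu> \<and>
      (\<forall>z\<in>ball 0 1. ?\<psi> z = (\<integral>w. z * cnj w / (1 - z * cnj w) \<partial>\<nu>))"
  proof (rule ex1I[of _ \<nu>])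
    fix \<nu>' assume "\<nu>' \<in> circle_measures \<and> prob_space \<nu>' \<and>
      (\<forall>z\<in>ball 0 1. ?\<psi> z = (\<integral>w. z * cnj w / (1 - z * cnj w) \<partial>\<nu>'))"
    then show "\<nu>' = \<nu>"
      using \<nu> rep by (intro herglotz_measure_unique) auto
  qed (use \<nu> rep in blast)
qed

end
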